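(* Consider a 3-user CGZIC $Y_1=X_1+Z_1$, $Y_2=X_2+a_1X_1+Z_2$, $Y_3=X_3+a_2X_2+Z_3$ with power constraints $P_1,P_2,P_3$, and suppose $1\le a_1<\sqrt{1+P_2}$ and $1\le a_2<\sqrt{1+P_3}$. Then the capacity region is the set of all nonnegative rate triples $(R_1,R_2,R_3)$ satisfying, for $i=1,2,3$ and $j=1,2$, \[ R_i\le \mathcal{C}(P_i),\qquad R_j\le \mathcal{C}(a_j^2P_j),\qquad R_j+R_{j+1}\le \mathcal{C}(a_j^2P_j+P_{j+1}). \]
   Context: The noises $Z_i\sim\mathcal N(0,1)$ are i.i.d. (independent across users and time), the channel is memoryless and real, user $i$ has average power constraint $P_i>0$, each receiver $i$ decodes only its own message $W_i$ from $Y_i^n$, and the capacity region is the closure of the set of achievable rate triples (rates for which the average error probability of every user tends to $0$ as blocklength grows). $\mathcal{C}(x)=\tfrac12\log_2(1+x)$. *)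

theory Defs
  imports "HOL-Probability.Probability"
begin

definition Cg :: "real \<Rightarrow> real" where
  "Cg x = 1/2 * log 2 (1 + x)"

definition gnoise :: "nat \<Rightarrow> (nat \<Rightarrow> real) measure" where
  "gnoise n = PiM {..<n} (\<lambda>_. density lborel std_normal_density)"

definition err_prob :: "nat \<Rightarrow> (nat \<Rightarrow> real) \<Rightarrow> ((nat \<Rightarrow> real) \<Rightarrow> nat) \<Rightarrow> nat \<Rightarrow> real" where
  "err_prob n x dec m =
     measure (gnoise n) {z \<in> space (gnoise n). dec (\<lambda>t\<in>{..<n}. x t + z t) \<noteq> m}"

definition avg_err :: "nat \<Rightarrow> nat \<Rightarrow> nat \<Rightarrow> nat \<Rightarrow> (nat \<Rightarrow> nat \<Rightarrow> nat \<Rightarrow> nat \<Rightarrow> real)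
     \<Rightarrow> ((nat \<Rightarrow> real) \<Rightarrow> nat) \<Rightarrow> (nat \<Rightarrow> nat \<Rightarrow> nat \<Rightarrow> nat) \<Rightarrow> real" where
  "avg_err n M1 M2 M3 sig dec sel =
     (\<Sum>m1<M1. \<Sum>m2<M2. \<Sum>m3<M3. err_prob n (sig m1 m2 m3) dec (sel m1 m2 m3))
       / real (M1 * M2 * M3)"

definition power_ok :: "nat \<Rightarrow> real \<Rightarrow> nat \<Rightarrow> (nat \<Rightarrow> nat \<Rightarrow> real) \<Rightarrow> bool" where
  "power_ok n P M enc \<longleftrightarrow> (\<forall>m<M. (\<Sum>t<n. (enc m t)\<^sup>2) \<le> real n * P)"

definition decoder_ok :: "nat \<Rightarrow> ((nat \<Rightarrow> real) \<Rightarrow> nat) \<Rightarrow> bool" where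
  "decoder_ok n dec \<longleftrightarrow> dec \<in> measurable (PiM {..<n} (\<lambda>_. lborel)) (count_space UNIV)"

text \<open>Achievable rate triples of the 3-user cascade Gaussian Z-interference channel
  Y1 = X1 + Z1, Y2 = X2 + a1 X1 + Z2, Y3 = X3 + a2 X2 + Z3: for every blocklength n there is
  a code with at least 2^(n R_i) messages for user i, satisfying the power constraints,
  with each user's average error probability tending to 0.\<close>
definition cgzic_achievable :: "real \<Rightarrow> real \<Rightarrow> real \<Rightarrow> real \<Rightarrow> real \<Rightarrow> (real \<times> real \<times> real) set" where
  "cgzic_achievable a1 a2 P1 P2 P3 = {(R1, R2, R3). 0 \<le> R1 \<and> 0 \<le> R2 \<and> 0 \<le> R3 \<and>
     (\<exists>(M1::nat\<Rightarrow>nat) (M2::nat\<Rightarrow>nat) (M3::nat\<Rightarrow>nat)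
        (e1::nat\<Rightarrow>nat\<Rightarrow>nat\<Rightarrow>real) (e2::nat\<Rightarrow>nat\<Rightarrow>nat\<Rightarrow>real) (e3::nat\<Rightarrow>nat\<Rightarrow>nat\<Rightarrow>real)
        (d1::nat\<Rightarrow>(nat\<Rightarrow>real)\<Rightarrow>nat) (d2::nat\<Rightarrow>(nat\<Rightarrow>real)\<Rightarrow>nat) (d3::nat\<Rightarrow>(nat\<Rightarrow>real)\<Rightarrow>nat).
        (\<forall>n. 2 powr (real n * R1) \<le> real (M1 n) \<and> 2 powr (real n * R2) \<le> real (M2 n)
             \<and> 2 powr (real n * R3) \<le> real (M3 n)
             \<and> power_ok n P1 (M1 n) (e1 n) \<and> power_ok n P2 (M2 n) (e2 n)
             \<and> power_ok n P3 (M3 n) (e3 n)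
             \<and> decoder_ok n (d1 n) \<and> decoder_ok n (d2 n) \<and> decoder_ok n (d3 n)) \<and>
        (\<lambda>n. avg_err n (M1 n) (M2 n) (M3 n) (\<lambda>m1 m2 m3. e1 n m1) (d1 n) (\<lambda>m1 m2 m3. m1))
           \<longlonglongrightarrow> 0 \<and>
        (\<lambda>n. avg_err n (M1 n) (M2 n) (M3 n) (\<lambda>m1 m2 m3 t. e2 n m2 t + a1 * e1 n m1 t) (d2 n)
              (\<lambda>m1 m2 m3. m2)) \<longlonglongrightarrow> 0 \<and>
        (\<lambda>n. avg_err n (M1 n) (M2 n) (M3 n) (\<lambda>m1 m2 m3 t. e3 n m3 t + a2 * e2 n m2 t) (d3 n)
              (\<lambda>m1 m2 m3. m3)) \<longlonglongrightarrow> 0)}"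

definition cgzic_capacity_region :: "real \<Rightarrow> real \<Rightarrow> real \<Rightarrow> real \<Rightarrow> real \<Rightarrow> (real \<times> real \<times> real) set" where
  "cgzic_capacity_region a1 a2 P1 P2 P3 = closure (cgzic_achievable a1 a2 P1 P2 P3)"

end

theory Submission
  imports Defs
begin

text \<open>
  Converse: if receiver B of a link YB = XB + a XA + Z decodes its own message, it can subtract
  XB and, since a \<ge> 1, add noise to obtain a copy of the output of receiver A; so it
  decodes both messages, and the sum rate is bounded as for a multiple access channel. The entropy bound is
  replaced by the variational form of relative entropy with respect to a Gaussian reference measure centred at
  the mean codeword, which needs second moments only.

  Achievability: Gaussian random codes, where receiver B jointly searches for a pair of codewords at distance
  about sqrt n from its output and only the message of B has to be unique. Every error event is estimated by an
  exponential moment of a squared Gaussian norm, so the whole analysis reduces to one Gaussian integral and a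
  union bound.
\<close>

text \<open>The cascade splits into the links 1 -> 2 and 2 -> 3, coupled only through user 2:
  receiver 2 plays the part of A in the second link while it hears \<open>a1\<close> X1 itself. In
  the converse this interference is a constant shift for each message of user 1, and the imitated
  output can contain the same shift. In the achievability part one codebook of user 2 must suit two
  receivers, so all error bounds are averaged together before a codebook is chosen.

  Centring at the mean codeword is what gives the power a^2 PA + PB: the second moment of xB + a xA
  over all message pairs has a mixed term, the product of the two codebook sums, which an arbitrary
  code need not make vanish.

  For the random code, the test "distance at most about sqrt n" alone is too weak in an exponential
  moment: exp(n/2) times the mean of exp(-|y - x'|^2/2) exceeds the capacity exponent by (1/2)
  ln(e/2) nats per symbol. Hence |y|^2 must also be typical from below; the factor exp(|y|^2/(2 V))
  which this supplies, with V the variance of y per symbol, turns the estimate into a likelihood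
  ratio and makes the exponent exact.\<close>

abbreviation stdn :: "real measure" where
  "stdn \<equiv> density lborel std_normal_density"

section \<open>White Gaussian noise and exponential moments of its squared norm\<close>

lemma prob_space_stdn: "prob_space stdn"
  by (rule prob_space_normal_density) simp

lemma product_sigma_finite_stdn: "product_sigma_finite (\<lambda>_::nat. stdn)"
proof -
  interpret prob_space stdn by (rule prob_space_stdn)
  show ?thesis
    by standard
qed

lemma prob_space_gnoise: "prob_space (gnoise n)"
  unfolding gnoise_def by (intro prob_space_PiM prob_space_stdn)

lemma sets_gnoise [measurable_cong]: "sets (gnoise n) = sets (PiM {..<n} (\<lambda>_. borel))"
  unfolding gnoise_def by (intro sets_PiM_cong) auto

lemma sets_PiM_lborel: "sets (PiM {..<n::nat} (\<lambda>_. lborel)) = sets (PiM {..<n} (\<lambda>_. borel :: real measure))"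
  by (intro sets_PiM_cong) auto

lemma nn_integral_gnoise_prod:
  assumes "\<And>t. t < n \<Longrightarrow> f t \<in> borel_measurable borel"
  shows "(\<integral>\<^sup>+z. (\<Prod>t<n. f t (z t)) \<partial>gnoise n) = (\<Prod>t<n. \<integral>\<^sup>+x. f t x \<partial>stdn)"
  unfolding gnoise_def
  by (rule product_sigma_finite.product_nn_integral_prod[OF product_sigma_finite_stdn])
     (use assms in auto)

lemma prod_indicator_PiE:
  assumes "x \<in> extensional I" "finite I"
  shows "(\<Prod>t\<in>I. indicator (A t) (x t) :: ennreal) = indicator (PiE I A) x"
proof (cases "x \<in> PiE I A")
  case True
  then show ?thesis by (auto simp: PiE_iff)
next
  case False
  then obtain t where "t \<in> I" "x t \<notin> A t" using assms by (auto simp: PiE_iff)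
  then show ?thesis using False assms by (auto intro!: prod_zero bexI[of _ t])
qed

text \<open>Completing the square turns the integrand into a constant times a normal density of
  variance 1/D, where D = 1 + 2 s c^2. The sign of \<open>s\<close> is free: negative values will
  serve upper tails, and D > 0 is exactly the condition for convergence.\<close>

lemma nn_integral_stdn_exp_square:
  assumes "0 < 1 + 2 * s * c\<^sup>2"
  shows "(\<integral>\<^sup>+w. ennreal (exp (- s * (y + c * w)\<^sup>2)) \<partial>stdn)
    = ennreal (exp (- s / (1 + 2 * s * c\<^sup>2) * y\<^sup>2) / sqrt (1 + 2 * s * c\<^sup>2))"
proof -
  define D where "D = 1 + 2 * s * c\<^sup>2"
  have D: "D > 0" using assms by (simp add: D_def)
  have s: "2 * s * c\<^sup>2 = D - 1" by (simp add: D_def)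
  have eq: "std_normal_density w * exp (- s * (y + c * w)\<^sup>2)
    = exp (- s / D * y\<^sup>2) / sqrt D * normal_density (- 2 * s * c * y / D) (1 / sqrt D) w" for w
  proof -
    have q: "w\<^sup>2 / 2 + s * (y + c * w)\<^sup>2 = s / D * y\<^sup>2 + D * (w + 2 * s * c * y / D)\<^sup>2 / 2"
    proof -
      have "D * (w + 2 * s * c * y / D)\<^sup>2 / 2 = D * w\<^sup>2 / 2 + 2 * s * c * y * w + 2 * s\<^sup>2 * c\<^sup>2 * y\<^sup>2 / D"
        using D by (simp add: power2_eq_square field_simps)
      also have "2 * s\<^sup>2 * c\<^sup>2 * y\<^sup>2 / D = s * (D - 1) * y\<^sup>2 / D"
        by (simp add: s[symmetric] power2_eq_square)
      also have "\<dots> = s * y\<^sup>2 - s / D * y\<^sup>2"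
        using D by (simp add: field_simps)
      also have "D * w\<^sup>2 / 2 = w\<^sup>2 / 2 + s * c\<^sup>2 * w\<^sup>2"
        by (simp add: D_def field_simps)
      finally show ?thesis by (simp add: power2_eq_square algebra_simps)
    qed
    have e: "exp (- (w\<^sup>2 / 2)) * exp (- s * (y + c * w)\<^sup>2)
       = exp (- s / D * y\<^sup>2) * exp (- (D * (w + 2 * s * c * y / D)\<^sup>2 / 2))"
      using q by (simp add: mult_exp_exp)
    have "sqrt (2 * pi * (1 / sqrt D)\<^sup>2) = sqrt (2 * pi) / sqrt D"
      using D by (simp add: power_divide real_sqrt_divide)
    then show ?thesis
      using e D by (simp add: normal_density_def power_divide field_simps)
  qed
  have "(\<integral>\<^sup>+w. ennreal (exp (- s * (y + c * w)\<^sup>2)) \<partial>stdn)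
     = (\<integral>\<^sup>+w. ennreal (std_normal_density w) * ennreal (exp (- s * (y + c * w)\<^sup>2)) \<partial>lborel)"
    by (subst nn_integral_density) auto
  also have "\<dots> = (\<integral>\<^sup>+w. ennreal (exp (- s / D * y\<^sup>2) / sqrt D) *
      ennreal (normal_density (- 2 * s * c * y / D) (1 / sqrt D) w) \<partial>lborel)"
    using D by (intro nn_integral_cong) (simp only: ennreal_mult'[symmetric] normal_density_nonneg eq divide_nonneg_nonneg exp_ge_zero real_sqrt_ge_zero less_imp_le)
  also have "\<dots> = ennreal (exp (- s / D * y\<^sup>2) / sqrt D) *
      (\<integral>\<^sup>+w. ennreal (normal_density (- 2 * s * c * y / D) (1 / sqrt D) w) \<partial>lborel)"
    by (intro nn_integral_cmult) auto
  also have "(\<integral>\<^sup>+w. ennreal (normal_density (- 2 * s * c * y / D) (1 / sqrt D) w) \<partial>lborel) = 1"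
    using D by (subst nn_integral_eq_integral) auto
  finally show ?thesis by (simp add: D_def)
qed

definition sqn :: "nat \<Rightarrow> (nat \<Rightarrow> real) \<Rightarrow> real" where
  "sqn n x = (\<Sum>t<n. (x t)\<^sup>2)"

lemma exp_sqn: "exp (s * sqn n x) = (\<Prod>t<n. exp (s * (x t)\<^sup>2))"
  by (simp add: sqn_def sum_distrib_left exp_sum)

lemma nn_integral_gnoise_exp_sqn:
  assumes "0 < 1 + 2 * s * c\<^sup>2"
  shows "(\<integral>\<^sup>+w. ennreal (exp (- s * sqn n (\<lambda>t. y t + c * w t))) \<partial>gnoise n)
    = ennreal (exp (- s / (1 + 2 * s * c\<^sup>2) * sqn n y) * (1 / sqrt (1 + 2 * s * c\<^sup>2)) ^ n)"
proof -
  have "(\<integral>\<^sup>+w. ennreal (exp (- s * sqn n (\<lambda>t. y t + c * w t))) \<partial>gnoise n)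
    = (\<integral>\<^sup>+w. (\<Prod>t<n. ennreal (exp (- s * (y t + c * w t)\<^sup>2))) \<partial>gnoise n)"
    by (simp only: exp_sqn prod_ennreal exp_ge_zero)
  also have "\<dots> = (\<Prod>t<n. ennreal (exp (- s / (1 + 2 * s * c\<^sup>2) * (y t)\<^sup>2) / sqrt (1 + 2 * s * c\<^sup>2)))"
    by (subst nn_integral_gnoise_prod) (simp_all only: nn_integral_stdn_exp_square[OF assms], measurable)
  also have "\<dots> = ennreal (\<Prod>t<n. exp (- s / (1 + 2 * s * c\<^sup>2) * (y t)\<^sup>2) / sqrt (1 + 2 * s * c\<^sup>2))"
    using assms by (intro prod_ennreal) auto
  also have "(\<Prod>t<n. exp (- s / (1 + 2 * s * c\<^sup>2) * (y t)\<^sup>2) / sqrt (1 + 2 * s * c\<^sup>2))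
     = exp (- s / (1 + 2 * s * c\<^sup>2) * sqn n y) * (1 / sqrt (1 + 2 * s * c\<^sup>2)) ^ n"
    unfolding exp_sqn by (simp add: prod_dividef power_one_over field_simps)
  finally show ?thesis .
qed

section \<open>Rotation and translation of Gaussian noise\<close>

text \<open>Variances of independent centred normals add, and here they add up to one. The converse
  uses this to bring noise that was divided by a channel gain back to unit variance.\<close>

lemma distr_stdn_rotation:
  assumes ab: "\<alpha>\<^sup>2 + \<beta>\<^sup>2 = 1" "\<alpha> > 0" "\<beta> \<ge> 0"
  shows "distr (stdn \<Otimes>\<^sub>M stdn) borel (\<lambda>(x, y). \<alpha> * x + \<beta> * y) = stdn"
proof -
  interpret N: prob_space stdn by (rule prob_space_stdn)
  interpret P: pair_prob_space stdn stdn ..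
  have fst: "distr (stdn \<Otimes>\<^sub>M stdn) stdn fst = stdn"
    by (rule N.distr_pair_fst)
  have snd: "distr (stdn \<Otimes>\<^sub>M stdn) stdn snd = stdn"
  proof (rule measure_eqI)
    fix A assume A: "A \<in> sets (distr (stdn \<Otimes>\<^sub>M stdn) stdn snd)"
    then have "snd -` A \<inter> space (stdn \<Otimes>\<^sub>M stdn) = UNIV \<times> A"
      by (auto simp: space_pair_measure)
    then show "emeasure (distr (stdn \<Otimes>\<^sub>M stdn) stdn snd) A = emeasure stdn A"
      using A N.emeasure_pair_measure_Times[of UNIV stdn A] N.emeasure_space_1
      by (simp add: emeasure_distr)
  qed simp
  have dX: "distributed (stdn \<Otimes>\<^sub>M stdn) lborel fst std_normal_density"
  proof -
    have "distr (stdn \<Otimes>\<^sub>M stdn) lborel fst = distr (stdn \<Otimes>\<^sub>M stdn) stdn fst"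
      by (rule distr_cong) auto
    then show ?thesis unfolding distributed_def using fst by auto
  qed
  have dY: "distributed (stdn \<Otimes>\<^sub>M stdn) lborel snd std_normal_density"
  proof -
    have "distr (stdn \<Otimes>\<^sub>M stdn) lborel snd = distr (stdn \<Otimes>\<^sub>M stdn) stdn snd"
      by (rule distr_cong) auto
    then show ?thesis unfolding distributed_def using snd by auto
  qed
  have ind: "P.indep_var stdn fst stdn snd"
    unfolding P.indep_var_distribution_eq fst snd by (auto simp: distr_id)
  show ?thesis
  \<comment> \<open>\<open>P.add_indep_normal\<close> asks for two positive standard deviations. The
    degenerate case \<beta> = 0 does occur: it is the gain a = 1, where no noise has to be
    added.\<close>
  proof (cases "\<beta> = 0")
    case True
    then have "\<alpha> = 1" using ab by (simp add: power2_eq_1_iff)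
    moreover have "distr (stdn \<Otimes>\<^sub>M stdn) borel fst = distr (stdn \<Otimes>\<^sub>M stdn) stdn fst"
      by (rule distr_cong) auto
    ultimately show ?thesis using True fst by (simp add: case_prod_beta')
  next
    case False
    then have b: "\<beta> > 0" using ab by simp
    have "P.indep_var borel ((\<lambda>x. \<alpha> * x) \<circ> fst) borel ((\<lambda>x. \<beta> * x) \<circ> snd)"
      by (rule P.indep_var_compose[OF ind]) auto
    then have ind': "P.indep_var borel (\<lambda>x. \<alpha> * fst x) borel (\<lambda>x. \<beta> * snd x)"
      by (simp add: o_def)
    have X: "distributed (stdn \<Otimes>\<^sub>M stdn) lborel (\<lambda>x. \<alpha> * fst x) (normal_density 0 \<alpha>)"
      using P.normal_density_affine[OF dX, of \<alpha> 0] ab by simp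
    have Y: "distributed (stdn \<Otimes>\<^sub>M stdn) lborel (\<lambda>x. \<beta> * snd x) (normal_density 0 \<beta>)"
      using P.normal_density_affine[OF dY, of \<beta> 0] b by simp
    have "distributed (stdn \<Otimes>\<^sub>M stdn) lborel (\<lambda>x. \<alpha> * fst x + \<beta> * snd x) std_normal_density"
      using P.add_indep_normal[OF ind' ab(2) b X Y] ab(1) by simp
    then have "distr (stdn \<Otimes>\<^sub>M stdn) lborel (\<lambda>x. \<alpha> * fst x + \<beta> * snd x) = stdn"
      by (simp add: distributed_def)
    moreover have "distr (stdn \<Otimes>\<^sub>M stdn) borel (\<lambda>x. \<alpha> * fst x + \<beta> * snd x) =
        distr (stdn \<Otimes>\<^sub>M stdn) lborel (\<lambda>x. \<alpha> * fst x + \<beta> * snd x)"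
      by (rule distr_cong) auto
    ultimately show ?thesis by (simp add: case_prod_beta')
  qed
qed

text \<open>A product measure is determined by its values on boxes, and on a box the double integral
  factors over the coordinates, so the scalar statement suffices.\<close>

lemma nn_integral_gnoise_rotation:
  assumes ab: "\<alpha>\<^sup>2 + \<beta>\<^sup>2 = 1" "\<alpha> > 0" "\<beta> \<ge> 0"
    and F[measurable]: "F \<in> borel_measurable (PiM {..<n} (\<lambda>_. borel))"
  shows "(\<integral>\<^sup>+z. \<integral>\<^sup>+z'. F (\<lambda>t\<in>{..<n}. \<alpha> * z t + \<beta> * z' t) \<partial>gnoise n \<partial>gnoise n) = (\<integral>\<^sup>+z. F z \<partial>gnoise n)"
proof -
  interpret N: prob_space stdn by (rule prob_space_stdn)
  interpret G: prob_space "gnoise n" by (rule prob_space_gnoise)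
  interpret NN: pair_prob_space stdn stdn ..
  interpret GG: pair_prob_space "gnoise n" "gnoise n" ..
  let ?T = "\<lambda>(z, z'). \<lambda>t\<in>{..<n}. \<alpha> * z t + \<beta> * z' t"
  have T[measurable]: "?T \<in> measurable (gnoise n \<Otimes>\<^sub>M gnoise n) (PiM {..<n} (\<lambda>_. borel))"
    unfolding case_prod_beta' by measurable
  have "distr (gnoise n \<Otimes>\<^sub>M gnoise n) (PiM {..<n} (\<lambda>_. borel)) ?T = PiM {..<n} (\<lambda>_. stdn)"
  proof (rule product_sigma_finite.PiM_eqI[OF product_sigma_finite_stdn])
    show "sets (distr (gnoise n \<Otimes>\<^sub>M gnoise n) (PiM {..<n} (\<lambda>_. borel)) ?T) = sets (PiM {..<n} (\<lambda>_. stdn))"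
      by (simp) (intro sets_PiM_cong, auto)
    fix A :: "nat \<Rightarrow> real set" assume "\<And>i. i \<in> {..<n} \<Longrightarrow> A i \<in> sets stdn"
    then have A: "A t \<in> sets borel" if "t < n" for t using that by auto
    then have PA: "PiE {..<n} A \<in> sets (PiM {..<n} (\<lambda>_. borel))"
      by (intro sets_PiM_I_finite) auto
    have "emeasure (distr (gnoise n \<Otimes>\<^sub>M gnoise n) (PiM {..<n} (\<lambda>_. borel)) ?T) (PiE {..<n} A)
      = (\<integral>\<^sup>+p. indicator (PiE {..<n} A) (?T p) \<partial>(gnoise n \<Otimes>\<^sub>M gnoise n))"
      using PA by (subst nn_integral_distr[OF T, symmetric]) auto
    also have "\<dots> = (\<integral>\<^sup>+z. \<integral>\<^sup>+z'. indicator (PiE {..<n} A) (?T (z, z')) \<partial>gnoise n \<partial>gnoise n)"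
      using PA by (subst G.nn_integral_fst[symmetric]) auto
    also have "\<dots> = (\<integral>\<^sup>+z. \<integral>\<^sup>+z'. (\<Prod>t<n. indicator (A t) (\<alpha> * z t + \<beta> * z' t)) \<partial>gnoise n \<partial>gnoise n)"
      by (intro nn_integral_cong, subst prod_indicator_PiE[symmetric]) auto
    also have "\<dots> = (\<integral>\<^sup>+z. (\<Prod>t<n. \<integral>\<^sup>+y. indicator (A t) (\<alpha> * z t + \<beta> * y) \<partial>stdn) \<partial>gnoise n)"
    proof (intro nn_integral_cong nn_integral_gnoise_prod)
      fix z t assume "t < n"
      then have [measurable]: "A t \<in> sets borel" by (rule A)
      show "(\<lambda>y. indicator (A t) (\<alpha> * z t + \<beta> * y) :: ennreal) \<in> borel_measurable borel" by measurable
    qed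
    also have "\<dots> = (\<Prod>t<n. \<integral>\<^sup>+x. \<integral>\<^sup>+y. indicator (A t) (\<alpha> * x + \<beta> * y) \<partial>stdn \<partial>stdn)"
    proof (rule nn_integral_gnoise_prod)
      fix t assume "t < n"
      then have [measurable]: "A t \<in> sets borel" by (rule A)
      show "(\<lambda>x. \<integral>\<^sup>+y. indicator (A t) (\<alpha> * x + \<beta> * y) \<partial>stdn) \<in> borel_measurable borel" by measurable
    qed
    also have "\<dots> = (\<Prod>t<n. emeasure stdn (A t))"
    proof (intro prod.cong refl)
      fix t assume "t \<in> {..<n}"
      then have At[measurable]: "A t \<in> sets borel" using A by simp
      have "(\<integral>\<^sup>+x. \<integral>\<^sup>+y. indicator (A t) (\<alpha> * x + \<beta> * y) \<partial>stdn \<partial>stdn)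
        = (\<integral>\<^sup>+p. indicator (A t) ((\<lambda>(x, y). \<alpha> * x + \<beta> * y) p) \<partial>(stdn \<Otimes>\<^sub>M stdn))"
        by (subst N.nn_integral_fst[symmetric]) auto
      also have "\<dots> = (\<integral>\<^sup>+x. indicator (A t) x \<partial>distr (stdn \<Otimes>\<^sub>M stdn) borel (\<lambda>(x, y). \<alpha> * x + \<beta> * y))"
        by (subst nn_integral_distr) auto
      finally show "(\<integral>\<^sup>+x. \<integral>\<^sup>+y. indicator (A t) (\<alpha> * x + \<beta> * y) \<partial>stdn \<partial>stdn) = emeasure stdn (A t)"
        by (simp add: distr_stdn_rotation[OF ab])
    qed
    finally show "emeasure (distr (gnoise n \<Otimes>\<^sub>M gnoise n) (PiM {..<n} (\<lambda>_. borel)) ?T) (PiE {..<n} A)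
       = (\<Prod>t<n. emeasure stdn (A t))" .
  qed simp
  then have eq: "distr (gnoise n \<Otimes>\<^sub>M gnoise n) (PiM {..<n} (\<lambda>_. borel)) ?T = gnoise n"
    by (simp add: gnoise_def)
  have "(\<integral>\<^sup>+z. \<integral>\<^sup>+z'. F (?T (z, z')) \<partial>gnoise n \<partial>gnoise n) = (\<integral>\<^sup>+p. F (?T p) \<partial>(gnoise n \<Otimes>\<^sub>M gnoise n))"
    by (subst G.nn_integral_fst[symmetric]) auto
  also have "\<dots> = (\<integral>\<^sup>+z. F z \<partial>gnoise n)"
    by (subst eq[symmetric], subst nn_integral_distr) auto
  finally show ?thesis by simp
qed

text \<open>Change of measure: weighting the noise with the ratio of the reference density to the
  true output density gives x + z the reference law. An expectation under the reference can
  therefore be written over the noise seen by any chosen codeword.\<close>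

lemma distr_density_gnoise_translate:
  assumes \<sigma>: "\<sigma> > 0"
  shows "distr (density (gnoise n) (\<lambda>z. \<Prod>t<n. ennreal (normal_density (\<mu> t) \<sigma> (x t + z t) / std_normal_density (z t))))
     (PiM {..<n} (\<lambda>_. borel)) (\<lambda>z. \<lambda>t\<in>{..<n}. x t + z t)
   = PiM {..<n} (\<lambda>t. density lborel (normal_density (\<mu> t) \<sigma>))" (is "distr (density _ ?r) ?B ?T = PiM _ ?Q")
proof (rule product_sigma_finite.PiM_eqI)
  interpret Q: prob_space "?Q t" for t by (rule prob_space_normal_density[OF \<sigma>])
  show "product_sigma_finite ?Q" ..
  show "sets (distr (density (gnoise n) ?r) ?B ?T) = sets (PiM {..<n} ?Q)"
    by simp (intro sets_PiM_cong, auto)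
  have T[measurable]: "?T \<in> measurable (gnoise n) ?B" by measurable
  have r[measurable]: "?r \<in> borel_measurable (gnoise n)" by measurable
  fix A :: "nat \<Rightarrow> real set" assume "\<And>i. i \<in> {..<n} \<Longrightarrow> A i \<in> sets (?Q i)"
  then have A: "A t \<in> sets borel" if "t < n" for t using that by auto
  then have PA[measurable]: "PiE {..<n} A \<in> sets ?B"
    by (intro sets_PiM_I_finite) auto
  have "emeasure (distr (density (gnoise n) ?r) ?B ?T) (PiE {..<n} A)
    = (\<integral>\<^sup>+z. indicator (PiE {..<n} A) (?T z) \<partial>density (gnoise n) ?r)"
    by (subst nn_integral_distr[of ?T _ ?B, symmetric]) (auto simp: nn_integral_indicator)
  also have "\<dots> = (\<integral>\<^sup>+z. ?r z * indicator (PiE {..<n} A) (?T z) \<partial>gnoise n)"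
    by (subst nn_integral_density) auto
  also have "\<dots> = (\<integral>\<^sup>+z. (\<Prod>t<n. ennreal (normal_density (\<mu> t) \<sigma> (x t + z t) / std_normal_density (z t))
      * indicator (A t) (x t + z t)) \<partial>gnoise n)"
    by (intro nn_integral_cong, subst prod_indicator_PiE[symmetric]) (auto simp: prod.distrib)
  also have "\<dots> = (\<Prod>t<n. \<integral>\<^sup>+z. ennreal (normal_density (\<mu> t) \<sigma> (x t + z) / std_normal_density z)
      * indicator (A t) (x t + z) \<partial>stdn)"
  proof (rule nn_integral_gnoise_prod)
    fix t assume "t < n"
    then have [measurable]: "A t \<in> sets borel" by (rule A)
    show "(\<lambda>z. ennreal (normal_density (\<mu> t) \<sigma> (x t + z) / std_normal_density z)
      * indicator (A t) (x t + z)) \<in> borel_measurable borel" by measurable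
  qed
  also have "\<dots> = (\<Prod>t<n. emeasure (?Q t) (A t))"
  proof (intro prod.cong refl)
    fix t assume "t \<in> {..<n}"
    then have [measurable]: "A t \<in> sets borel" using A by simp
    have "(\<integral>\<^sup>+z. ennreal (normal_density (\<mu> t) \<sigma> (x t + z) / std_normal_density z)
        * indicator (A t) (x t + z) \<partial>stdn)
      = (\<integral>\<^sup>+z. ennreal (std_normal_density z) * (ennreal (normal_density (\<mu> t) \<sigma> (x t + z) / std_normal_density z)
        * indicator (A t) (x t + z)) \<partial>lborel)"
      by (subst nn_integral_density) auto
    also have "\<dots> = (\<integral>\<^sup>+z. ennreal (normal_density (\<mu> t) \<sigma> (x t + 1 * z)) * indicator (A t) (x t + 1 * z) \<partial>lborel)"
    proof (intro nn_integral_cong)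
      fix z :: real
      have "std_normal_density z > 0" by (rule normal_density_pos) simp
      then have "ennreal (std_normal_density z) * ennreal (normal_density (\<mu> t) \<sigma> (x t + z) / std_normal_density z)
        = ennreal (normal_density (\<mu> t) \<sigma> (x t + z))"
        by (subst ennreal_mult[symmetric]) auto
      then show "ennreal (std_normal_density z) * (ennreal (normal_density (\<mu> t) \<sigma> (x t + z) / std_normal_density z)
        * indicator (A t) (x t + z)) = ennreal (normal_density (\<mu> t) \<sigma> (x t + 1 * z)) * indicator (A t) (x t + 1 * z)"
        by (simp add: mult.assoc[symmetric])
    qed
    also have "\<dots> = (\<integral>\<^sup>+y. ennreal (normal_density (\<mu> t) \<sigma> y) * indicator (A t) y \<partial>lborel)"
      using nn_integral_real_affine[of "\<lambda>y. ennreal (normal_density (\<mu> t) \<sigma> y) * indicator (A t) y" 1 "x t"] by simp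
    also have "\<dots> = emeasure (?Q t) (A t)"
      by (subst emeasure_density) auto
    finally show "(\<integral>\<^sup>+z. ennreal (normal_density (\<mu> t) \<sigma> (x t + z) / std_normal_density z)
        * indicator (A t) (x t + z) \<partial>stdn) = emeasure (?Q t) (A t)" .
  qed
  finally show "emeasure (distr (density (gnoise n) ?r) ?B ?T) (PiE {..<n} A) = (\<Prod>t<n. emeasure (?Q t) (A t))" .
qed simp

section \<open>Relative entropy bound for one Gaussian receiver\<close>

text \<open>The exponent is minus the log-likelihood ratio of the output x + z against the reference
  N(\<mu>, V); the mean of that ratio over z is the relative entropy.\<close>

lemma log_likelihood_ratio:
  assumes V: "V > 0"
  shows "(\<Prod>t<n. normal_density (\<mu> t) (sqrt V) (x t + z t) / std_normal_density (z t))
    = exp (- (real n / 2 * ln V + sqn n (\<lambda>t. x t - \<mu> t + z t) / (2 * V) - sqn n z / 2))"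
proof -
  have "normal_density (\<mu> t) (sqrt V) (x t + z t) / std_normal_density (z t)
     = exp (- (1 / 2 * ln V + (x t - \<mu> t + z t)\<^sup>2 / (2 * V) - (z t)\<^sup>2 / 2))" for t
  proof -
    have "exp (1 / 2 * ln V) = sqrt V" using V by (simp add: ln_sqrt[symmetric])
    then have e: "exp (- (1 / 2 * ln V)) = 1 / sqrt V" by (simp add: exp_minus inverse_eq_divide)
    have "exp (- (1 / 2 * ln V + (x t - \<mu> t + z t)\<^sup>2 / (2 * V) - (z t)\<^sup>2 / 2))
      = exp (- (1 / 2 * ln V)) * exp (- (x t - \<mu> t + z t)\<^sup>2 / (2 * V)) / exp (- (z t)\<^sup>2 / 2)"
      by (simp only: mult_exp_exp exp_diff[symmetric]) (simp add: algebra_simps)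
    also have "\<dots> = normal_density (\<mu> t) (sqrt V) (x t + z t) / std_normal_density (z t)"
      unfolding e using V by (simp add: normal_density_def real_sqrt_mult algebra_simps)
    finally show ?thesis by simp
  qed
  then have "(\<Prod>t<n. normal_density (\<mu> t) (sqrt V) (x t + z t) / std_normal_density (z t))
     = exp (\<Sum>t<n. - (1 / 2 * ln V + (x t - \<mu> t + z t)\<^sup>2 / (2 * V) - (z t)\<^sup>2 / 2))"
    by (simp only: exp_sum finite_lessThan)
  also have "(\<Sum>t<n. - (1 / 2 * ln V + (x t - \<mu> t + z t)\<^sup>2 / (2 * V) - (z t)\<^sup>2 / 2))
    = - (real n / 2 * ln V + sqn n (\<lambda>t. x t - \<mu> t + z t) / (2 * V) - sqn n z / 2)"
    by (simp add: sqn_def sum_negf sum.distrib sum_subtractf sum_divide_distrib)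
  finally show ?thesis .
qed

lemma stdn_second_moment:
  "integrable stdn (\<lambda>z. (u + z)\<^sup>2)" "(\<integral>z. (u + z)\<^sup>2 \<partial>stdn) = u\<^sup>2 + 1"
proof -
  have "has_bochner_integral lborel (\<lambda>z. std_normal_density z * z\<^sup>2 + 2 * u * (std_normal_density z * z) + u\<^sup>2 * std_normal_density z)
     (1 + 2 * u * 0 + u\<^sup>2 * 1)"
    using std_normal_moment_even[of 1] std_normal_moment_odd[of 0]
    by (intro has_bochner_integral_add has_bochner_integral_mult_right)
       (auto simp: has_bochner_integral_iff)
  then have *: "has_bochner_integral lborel (\<lambda>z. std_normal_density z *\<^sub>R (u + z)\<^sup>2) (u\<^sup>2 + 1)"
    by (rule has_bochner_integral_cong[THEN iffD1, rotated -1]) (auto simp: power2_eq_square algebra_simps)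
  then have "has_bochner_integral stdn (\<lambda>z. (u + z)\<^sup>2) (u\<^sup>2 + 1)"
    by (intro has_bochner_integral_density) auto
  then show "integrable stdn (\<lambda>z. (u + z)\<^sup>2)" "(\<integral>z. (u + z)\<^sup>2 \<partial>stdn) = u\<^sup>2 + 1"
    by (auto simp: has_bochner_integral_iff)
qed

lemma gnoise_second_moment:
  "integrable (gnoise n) (\<lambda>z. sqn n (\<lambda>t. u t + z t))"
  "(\<integral>z. sqn n (\<lambda>t. u t + z t) \<partial>gnoise n) = sqn n u + real n"
proof -
  have d: "distr (gnoise n) stdn (\<lambda>z. z t) = stdn" if "t < n" for t
    unfolding gnoise_def using that by (intro distr_PiM_component prob_space_stdn) auto
  have m: "(\<lambda>z. z t) \<in> measurable (gnoise n) stdn" if "t < n" for t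
    unfolding gnoise_def using that by auto
  have i: "integrable (gnoise n) (\<lambda>z. (u t + z t)\<^sup>2)" if "t < n" for t
    using integrable_distr[OF m[OF that], of "\<lambda>y. (u t + y)\<^sup>2"] d[OF that] stdn_second_moment(1) by auto
  show "integrable (gnoise n) (\<lambda>z. sqn n (\<lambda>t. u t + z t))"
    unfolding sqn_def using i by auto
  have "(\<integral>z. (u t + z t)\<^sup>2 \<partial>gnoise n) = (u t)\<^sup>2 + 1" if "t < n" for t
    using integral_distr[OF m[OF that], of "\<lambda>y. (u t + y)\<^sup>2"] d[OF that] stdn_second_moment(2) by auto
  then show "(\<integral>z. sqn n (\<lambda>t. u t + z t) \<partial>gnoise n) = sqn n u + real n"
    unfolding sqn_def using i by (simp add: sum.distrib)
qed

text \<open>Here g m y is the probability that a randomised decoder outputs m on input y; randomisation is needed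
  because receiver B adds artificial noise before imitating receiver A.\<close>
lemma gaussian_converse:
  fixes x :: "'m \<Rightarrow> nat \<Rightarrow> real" and g :: "'m \<Rightarrow> (nat \<Rightarrow> real) \<Rightarrow> real"
  assumes I: "finite I" "I \<noteq> {}"
    and g[measurable]: "\<And>m. m \<in> I \<Longrightarrow> g m \<in> borel_measurable (PiM {..<n} (\<lambda>_. borel))"
    and g0: "\<And>m y. m \<in> I \<Longrightarrow> 0 \<le> g m y"
    and g1: "\<And>y. y \<in> PiE {..<n} (\<lambda>_. UNIV) \<Longrightarrow> (\<Sum>m\<in>I. g m y) \<le> 1"
    and S: "0 \<le> S"
    and power: "(\<Sum>m\<in>I. sqn n (\<lambda>t. x m t - \<mu> t)) \<le> real (card I) * (real n * S)"
  shows "(\<Sum>m\<in>I. \<integral>z. g m (\<lambda>t\<in>{..<n}. x m t + z t) \<partial>gnoise n) * ln (real (card I))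
     \<le> real (card I) * (real n / 2 * ln (1 + S) + ln 2)"
proof -
  interpret G: prob_space "gnoise n" by (rule prob_space_gnoise)
  \<comment> \<open>Noise plus signal power. For this variance the quadratic parts of the relative
    entropies cancel after averaging over the messages, and n/2 * ln V per message remains.\<close>
  define V where "V = 1 + S"
  have V: "V \<ge> 1" "V > 0" using S by (auto simp: V_def)
  define M where "M = real (card I)"
  have M: "M \<ge> 1" using I unfolding M_def by (simp add: Suc_le_eq card_gt_0_iff)
  let ?B = "PiM {..<n} (\<lambda>_. borel) :: (nat \<Rightarrow> real) measure"
  define Q where "Q = PiM {..<n} (\<lambda>t. density lborel (normal_density (\<mu> t) (sqrt V)))"
  interpret Q: prob_space Q unfolding Q_def using V by (intro prob_space_PiM prob_space_normal_density) auto
  have sQ[measurable_cong]: "sets Q = sets ?B" unfolding Q_def by (intro sets_PiM_cong) auto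
  have spQ: "space Q = PiE {..<n} (\<lambda>_. UNIV)" unfolding Q_def by (simp add: space_PiM)
  define L where "L m z = real n / 2 * ln V + sqn n (\<lambda>t. x m t - \<mu> t + z t) / (2 * V) - sqn n z / 2" for m z
  let ?T = "\<lambda>m z. \<lambda>t\<in>{..<n}. x m t + z t"
  have T[measurable]: "?T m \<in> measurable (gnoise n) ?B" for m by measurable
  have Lm[measurable]: "L m \<in> borel_measurable (gnoise n)" for m unfolding L_def sqn_def by measurable
  have gle: "g m y \<le> 1" if "m \<in> I" "y \<in> PiE {..<n} (\<lambda>_. UNIV)" for m y
    using member_le_sum[of m I "\<lambda>m. g m y"] g0 g1[OF that(2)] that I by force
  have gT: "?T m z \<in> PiE {..<n} (\<lambda>_. UNIV)" for m z by auto
  \<comment> \<open>\<open>L m\<close> is the logarithm of dP_m/dQ along the output of codeword m,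
    where P_m is its output law; hence exp (- L m) carries the noise to \<open>Q\<close>.\<close>
  have dist: "distr (density (gnoise n) (\<lambda>z. ennreal (exp (- L m z)))) ?B (?T m) = Q" for m
  proof -
    have "ennreal (exp (- L m z)) = (\<Prod>t<n. ennreal (normal_density (\<mu> t) (sqrt V) (x m t + z t) / std_normal_density (z t)))" for z
      unfolding L_def by (subst log_likelihood_ratio[OF V(2), symmetric], rule prod_ennreal[symmetric]) auto
    then show ?thesis unfolding Q_def
      using distr_density_gnoise_translate[of "sqrt V" n \<mu> "x m"] V by simp
  qed
  have chg: "integrable (gnoise n) (\<lambda>z. exp (- L m z) * h (?T m z)) \<and>
      (\<integral>z. exp (- L m z) * h (?T m z) \<partial>gnoise n) = (\<integral>y. h y \<partial>Q)"
    if h[measurable]: "h \<in> borel_measurable ?B" and i: "integrable Q h" for m and h :: "_ \<Rightarrow> real"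
  proof -
    have "integrable (density (gnoise n) (\<lambda>z. ennreal (exp (- L m z)))) (\<lambda>z. h (?T m z))"
      using i dist[of m, symmetric] by (subst integrable_distr_eq[symmetric, of _ _ ?B]) auto
    then have 1: "integrable (gnoise n) (\<lambda>z. exp (- L m z) * h (?T m z))"
      by (subst (asm) integrable_density) auto
    have "(\<integral>y. h y \<partial>Q) = (\<integral>z. h (?T m z) \<partial>density (gnoise n) (\<lambda>z. ennreal (exp (- L m z))))"
      by (subst dist[of m, symmetric], subst integral_distr) auto
    also have "\<dots> = (\<integral>z. exp (- L m z) * h (?T m z) \<partial>gnoise n)"
      by (subst integral_density) auto
    finally show ?thesis using 1 by simp
  qed
  have iL: "integrable (gnoise n) (L m)" for m
    unfolding L_def using gnoise_second_moment(1)[of n "\<lambda>t. x m t - \<mu> t"] gnoise_second_moment(1)[of n "\<lambda>t. 0"]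
    by auto
  have EL: "(\<integral>z. L m z \<partial>gnoise n) = real n / 2 * ln V + (sqn n (\<lambda>t. x m t - \<mu> t) + real n) / (2 * V) - real n / 2" for m
    unfolding L_def using gnoise_second_moment[of n "\<lambda>t. x m t - \<mu> t"] gnoise_second_moment[of n "\<lambda>t. 0"]
    by (simp add: G.prob_space sqn_def)
  define q where "q m = (\<integral>y. g m y \<partial>Q)" for m
  have igQ: "integrable Q (g m)" if "m \<in> I" for m
    using that g0 gle by (intro Q.integrable_const_bound[where B=1]) (auto simp: spQ intro!: AE_I2)
  have igG: "integrable (gnoise n) (\<lambda>z. g m (?T m z))" if "m \<in> I" for m
  proof -
    have [measurable]: "g m \<in> borel_measurable ?B" using that by (rule g)
    show ?thesis
      using that g0 gle[OF that gT] by (intro G.integrable_const_bound[where B=1] AE_I2) auto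
  qed
  \<comment> \<open>The variational inequality: 1 + X <= exp X for X = g ln M - L - ln 2, integrated
    over the noise. The integral of \<open>L m\<close> is the relative entropy, and the change of
    measure makes the right side an expectation under \<open>Q\<close>, which is the same for all
    messages.\<close>
  have main: "(\<integral>z. g m (?T m z) \<partial>gnoise n) * ln M - (\<integral>z. L m z \<partial>gnoise n) - ln 2
      \<le> (1 + (M - 1) * q m) / 2 - 1" if m: "m \<in> I" for m
  proof -
    have [measurable]: "g m \<in> borel_measurable ?B" using m by (rule g)
    have c1: "integrable (gnoise n) (\<lambda>z. exp (- L m z) * (1 + (M - 1) * g m (?T m z)))"
      and c2: "(\<integral>z. exp (- L m z) * (1 + (M - 1) * g m (?T m z)) \<partial>gnoise n) = 1 + (M - 1) * q m"
      using chg[of "\<lambda>y. 1 + (M - 1) * g m y" m] igQ[OF m] by (auto simp: q_def Q.prob_space)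
    have pw: "g m (?T m z) * ln M - L m z - ln 2 \<le> exp (- L m z) * (1 + (M - 1) * g m (?T m z)) / 2 - 1" for z
    proof -
      let ?\<gamma> = "g m (?T m z)"
      have \<gamma>: "0 \<le> ?\<gamma>" "?\<gamma> \<le> 1" using g0[OF m] gle[OF m gT] by auto
      \<comment> \<open>Convexity of exp between 0 and ln M replaces M^g by a function linear in g,
        so that the outputs of a randomised decoder can be summed over the messages.\<close>
      have "exp (?\<gamma> * ln M) \<le> 1 + (M - 1) * ?\<gamma>"
      proof -
        have "exp ((1 - ?\<gamma>) *\<^sub>R 0 + ?\<gamma> *\<^sub>R ln M) \<le> (1 - ?\<gamma>) * exp 0 + ?\<gamma> * exp (ln M)"
          by (rule convex_onD[OF exp_convex]) (use \<gamma> in auto)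
        then show ?thesis using M by (simp add: algebra_simps)
      qed
      then have "exp (- L m z) * exp (?\<gamma> * ln M) \<le> exp (- L m z) * (1 + (M - 1) * ?\<gamma>)" by simp
      moreover have "exp (?\<gamma> * ln M - L m z - ln 2) = exp (- L m z) * exp (?\<gamma> * ln M) / 2"
        by (simp add: exp_diff exp_minus exp_add field_simps)
      moreover have "1 + (?\<gamma> * ln M - L m z - ln 2) \<le> exp (?\<gamma> * ln M - L m z - ln 2)" by (rule exp_ge_add_one_self)
      ultimately show ?thesis by linarith
    qed
    have "(\<integral>z. g m (?T m z) * ln M - L m z - ln 2 \<partial>gnoise n)
      \<le> (\<integral>z. exp (- L m z) * (1 + (M - 1) * g m (?T m z)) / 2 - 1 \<partial>gnoise n)"
      by (rule integral_mono[OF _ _ pw]) (use c1 iL igG[OF m] in auto)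
    then show ?thesis using c1 c2 iL[of m] igG[OF m] by (simp add: G.prob_space)
  qed
  have "(\<Sum>m\<in>I. q m) = (\<integral>y. (\<Sum>m\<in>I. g m y) \<partial>Q)"
    unfolding q_def using igQ by (subst Bochner_Integration.integral_sum) auto
  also have "\<dots> \<le> (\<integral>y. 1 \<partial>Q)"
    using igQ by (intro integral_mono) (auto simp: spQ intro!: g1)
  finally have q: "(\<Sum>m\<in>I. q m) \<le> 1" by (simp add: Q.prob_space)
  have "(\<Sum>m\<in>I. (\<integral>z. g m (?T m z) \<partial>gnoise n) * ln M - (\<integral>z. L m z \<partial>gnoise n) - ln 2)
      \<le> (\<Sum>m\<in>I. (1 + (M - 1) * q m) / 2 - 1)"
    by (intro sum_mono main)
  also have "\<dots> = (M - 1) * (\<Sum>m\<in>I. q m) / 2 - M / 2"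
    by (simp add: M_def sum_subtractf sum.distrib add_divide_distrib sum_divide_distrib sum_distrib_left)
  \<comment> \<open>Under \<open>Q\<close> the decoding probabilities of all messages sum to at most
    one. Subtracting ln 2 in X has halved the exponential, which is just enough: the total is
    -1/2.\<close>
  also have "\<dots> \<le> (M - 1) * 1 / 2 - M / 2"
    using M q by (intro diff_right_mono divide_right_mono mult_left_mono) auto
  also have "\<dots> \<le> 0" by simp
  finally have "(\<Sum>m\<in>I. (\<integral>z. g m (?T m z) \<partial>gnoise n)) * ln M \<le> (\<Sum>m\<in>I. (\<integral>z. L m z \<partial>gnoise n)) + M * ln 2"
    by (simp add: sum_subtractf M_def sum_distrib_right)
  moreover have "(\<Sum>m\<in>I. (\<integral>z. L m z \<partial>gnoise n)) \<le> M * (real n / 2 * ln V)"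
  proof -
    have "(\<Sum>m\<in>I. (\<integral>z. L m z \<partial>gnoise n)) =
       M * (real n / 2 * ln V - real n / 2) + ((\<Sum>m\<in>I. sqn n (\<lambda>t. x m t - \<mu> t)) + M * real n) / (2 * V)"
      unfolding EL by (simp add: sum.distrib sum_subtractf M_def sum_divide_distrib[symmetric] algebra_simps)
    also have "\<dots> \<le> M * (real n / 2 * ln V - real n / 2) + (M * (real n * S) + M * real n) / (2 * V)"
      using power V by (intro add_left_mono divide_right_mono add_right_mono) (auto simp: M_def)
    also have "(M * (real n * S) + M * real n) / (2 * V) = M * real n / 2"
      using V by (simp add: V_def field_simps)
    finally show ?thesis by (simp add: algebra_simps)
  qed
  ultimately have "(\<Sum>m\<in>I. (\<integral>z. g m (?T m z) \<partial>gnoise n)) * ln M \<le> M * (real n / 2 * ln V + ln 2)"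
    by (simp only: distrib_left)
  then show ?thesis unfolding M_def V_def .
qed

lemma decoder_measurable:
  "decoder_ok n dec \<Longrightarrow> dec \<in> measurable (PiM {..<n} (\<lambda>_. borel)) (count_space UNIV)"
  unfolding decoder_ok_def using measurable_cong_sets[OF sets_PiM_lborel refl] by blast

lemma sum_decoding_indicator_le_1:
  fixes dec :: "'a \<Rightarrow> nat"
  shows "(\<Sum>m<M. indicator {y. dec y = m} y) \<le> (1::real)"
proof -
  have "(\<Sum>m<M. indicator {y. dec y = m} y) = (\<Sum>m<M. if dec y = m then 1 else (0::real))"
    by (intro sum.cong) (auto split: split_indicator)
  also have "\<dots> \<le> 1" by (subst sum.delta') auto
  finally show ?thesis .
qed

lemma success_prob:
  assumes dec: "decoder_ok n dec"
  shows "(\<integral>z. indicator {y. dec y = m} (\<lambda>t\<in>{..<n}. x t + z t) \<partial>gnoise n) = 1 - err_prob n x dec m"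
proof -
  interpret G: prob_space "gnoise n" by (rule prob_space_gnoise)
  note [measurable] = decoder_measurable[OF dec]
  let ?E = "{z \<in> space (gnoise n). dec (\<lambda>t\<in>{..<n}. x t + z t) \<noteq> m}"
  have E[measurable]: "?E \<in> sets (gnoise n)" by measurable
  have "(\<integral>z. indicator {y. dec y = m} (\<lambda>t\<in>{..<n}. x t + z t) \<partial>gnoise n)
     = (\<integral>z. indicator (space (gnoise n) - ?E) z \<partial>gnoise n)"
    by (intro Bochner_Integration.integral_cong) (auto split: split_indicator)
  also have "\<dots> = G.prob (space (gnoise n) - ?E)" by simp
  also have "\<dots> = 1 - err_prob n x dec m" unfolding err_prob_def by (rule G.prob_compl) simp
  finally show ?thesis .
qed

text \<open>For fixed interfering messages \<open>v\<close> is a constant vector. A reference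
  measure centred at \<open>v\<close> sees only the power of the codeword itself, so the bound is
  uniform in the interference.\<close>

lemma point_to_point_converse:
  assumes M: "M > 0" and P: "P \<ge> 0" and pw: "power_ok n P M enc" and dec: "decoder_ok n dec"
  shows "(real M - (\<Sum>m<M. err_prob n (\<lambda>t. enc m t + v t) dec m)) * ln (real M)
    \<le> real M * (real n / 2 * ln (1 + P) + ln 2)"
proof -
  note [measurable] = decoder_measurable[OF dec]
  have "(\<Sum>m\<in>{..<M}. \<integral>z. indicator {y. dec y = m} (\<lambda>t\<in>{..<n}. enc m t + v t + z t) \<partial>gnoise n) * ln (real (card {..<M}))
     \<le> real (card {..<M}) * (real n / 2 * ln (1 + P) + ln 2)"
  proof (rule gaussian_converse[where \<mu>=v])
    show "(\<Sum>m<M. indicator {y. dec y = m} y) \<le> (1::real)" for y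
      by (rule sum_decoding_indicator_le_1)
    have "(\<Sum>m<M. sqn n (\<lambda>t. enc m t + v t - v t)) \<le> (\<Sum>m<M. real n * P)"
      using pw by (intro sum_mono) (auto simp: power_ok_def sqn_def)
    then show "(\<Sum>m<M. sqn n (\<lambda>t. enc m t + v t - v t)) \<le> real (card {..<M}) * (real n * P)" by simp
  qed (use M P in auto)
  then show ?thesis by (simp add: success_prob[OF dec] sum_subtractf)
qed

section \<open>Converse for one Z link\<close>

lemma sum_centered_le:
  fixes f :: "nat \<Rightarrow> real"
  assumes "M > 0"
  defines "c \<equiv> (\<Sum>i<M. f i) / real M"
  shows "(\<Sum>i<M. f i - c) = 0" "(\<Sum>i<M. (f i - c)\<^sup>2) \<le> (\<Sum>i<M. (f i)\<^sup>2)"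
proof -
  show 0: "(\<Sum>i<M. f i - c) = 0" using assms by (simp add: sum_subtractf)
  have "(\<Sum>i<M. (f i)\<^sup>2) = (\<Sum>i<M. (f i - c)\<^sup>2 + 2 * c * (f i - c) + c\<^sup>2)"
    by (intro sum.cong) (auto simp: power2_eq_square algebra_simps)
  also have "\<dots> = (\<Sum>i<M. (f i - c)\<^sup>2) + 2 * c * (\<Sum>i<M. f i - c) + real M * c\<^sup>2"
    by (simp only: sum.distrib sum_distrib_left[symmetric]) simp
  finally show "(\<Sum>i<M. (f i - c)\<^sup>2) \<le> (\<Sum>i<M. (f i)\<^sup>2)" using 0 by simp
qed

text \<open>With both families centred the mixed term has the factor sum (g j - d) = 0, and centring
  only lowers second moments. This is where a^2 PA + PB comes from without any assumption on the
  means of the codebooks.\<close>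

lemma sum_centered_pair_le:
  fixes f g :: "nat \<Rightarrow> real"
  assumes "M > 0" "N > 0"
  defines "c \<equiv> (\<Sum>i<M. f i) / real M" and "d \<equiv> (\<Sum>j<N. g j) / real N"
  shows "(\<Sum>i<M. \<Sum>j<N. (g j + a * f i - (d + a * c))\<^sup>2)
     \<le> real M * (\<Sum>j<N. (g j)\<^sup>2) + a\<^sup>2 * real N * (\<Sum>i<M. (f i)\<^sup>2)"
proof -
  note F = sum_centered_le[OF assms(1), of f, folded c_def]
  note G = sum_centered_le[OF assms(2), of g, folded d_def]
  have "(\<Sum>j<N. (g j + a * f i - (d + a * c))\<^sup>2) = (\<Sum>j<N. (g j - d)\<^sup>2) + real N * a\<^sup>2 * (f i - c)\<^sup>2" for i
  proof -
    have "(\<Sum>j<N. (g j + a * f i - (d + a * c))\<^sup>2) = (\<Sum>j<N. (g j - d)\<^sup>2 + 2 * a * (f i - c) * (g j - d) + a\<^sup>2 * (f i - c)\<^sup>2)"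
      by (intro sum.cong) (auto simp: power2_eq_square algebra_simps)
    also have "\<dots> = (\<Sum>j<N. (g j - d)\<^sup>2) + 2 * a * (f i - c) * (\<Sum>j<N. g j - d) + real N * (a\<^sup>2 * (f i - c)\<^sup>2)"
      by (simp only: sum.distrib sum_distrib_left[symmetric]) simp
    finally show ?thesis using G(1) by simp
  qed
  then have "(\<Sum>i<M. \<Sum>j<N. (g j + a * f i - (d + a * c))\<^sup>2)
     = real M * (\<Sum>j<N. (g j - d)\<^sup>2) + a\<^sup>2 * real N * (\<Sum>i<M. (f i - c)\<^sup>2)"
    by (simp add: sum.distrib sum_distrib_left mult_ac)
  also have "\<dots> \<le> real M * (\<Sum>j<N. (g j)\<^sup>2) + a\<^sup>2 * real N * (\<Sum>i<M. (f i)\<^sup>2)"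
    using F(2) G(2) by (intro add_mono mult_left_mono) auto
  finally show ?thesis .
qed

text \<open>Only the marginal laws of the two outputs enter, since the statement is about a sum of
  error probabilities; the copy of A's output may thus be built from B's noise although the true
  noise of A is independent of it. The vector \<open>v\<close> is interference at A from outside the
  link, which the imitation adds by hand.\<close>

lemma z_channel_converse:
  fixes encA encB :: "nat \<Rightarrow> nat \<Rightarrow> real"
  assumes M: "MA > 0" "MB > 0" and P: "PA \<ge> 0" "PB \<ge> 0" and a: "a \<ge> 1"
    and pwA: "power_ok n PA MA encA" and pwB: "power_ok n PB MB encB"
    and decA: "decoder_ok n decA" and decB: "decoder_ok n decB"
  shows "(real (MA * MB) - (\<Sum>i<MA. \<Sum>j<MB. err_prob n (\<lambda>t. encA i t + v t) decA i
          + err_prob n (\<lambda>t. encB j t + a * encA i t) decB j)) * ln (real (MA * MB))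
    \<le> real (MA * MB) * (real n / 2 * ln (1 + (a\<^sup>2 * PA + PB)) + ln 2)"
proof -
  interpret G: prob_space "gnoise n" by (rule prob_space_gnoise)
  note [measurable] = decoder_measurable[OF decA] decoder_measurable[OF decB]
  \<comment> \<open>Division by a leaves noise of variance \<alpha>^2 <= 1, and fresh noise scaled
    by \<beta> makes up the difference to one.\<close>
  define \<alpha> where "\<alpha> = 1 / a"
  define \<beta> where "\<beta> = sqrt (1 - \<alpha>\<^sup>2)"
  have al: "\<alpha> > 0" "\<alpha> \<le> 1" "\<alpha> * a = 1" using a by (auto simp: \<alpha>_def)
  then have al2: "\<alpha>\<^sup>2 \<le> 1" by (simp add: power_le_one)
  have be: "\<beta> \<ge> 0" "\<alpha>\<^sup>2 + \<beta>\<^sup>2 = 1" using al2 by (auto simp: \<beta>_def)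
  let ?B = "PiM {..<n} (\<lambda>_. borel) :: (nat \<Rightarrow> real) measure"
  define h where "h i j y z' = (indicator {y. decA y = i} (\<lambda>t\<in>{..<n}. \<alpha> * (y t - encB j t) + v t + \<beta> * z' t) :: real)"
    for i j :: nat and y z' :: "nat \<Rightarrow> real"
  have hm[measurable]: "(\<lambda>(y, z'). h i j y z') \<in> borel_measurable (?B \<Otimes>\<^sub>M gnoise n)" for i j
    unfolding h_def case_prod_beta' by measurable
  \<comment> \<open>The codeword subtracted inside \<open>h\<close> is that of the decoded j. The
    weights sum to at most one because \<open>decB\<close> selects one j and then, for every z',
    \<open>decA\<close> selects one i.\<close>
  define g where "g = (\<lambda>(i, j) y. indicator {y. decB y = j} y * (\<integral>z'. h i j y z' \<partial>gnoise n))"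
  have h01: "0 \<le> h i j y z'" "h i j y z' \<le> 1" for i j y z' by (auto simp: h_def)
  have hm2[measurable]: "h i j y \<in> borel_measurable (gnoise n)" for i j y
    unfolding h_def by measurable
  have ih: "integrable (gnoise n) (h i j y)" for i j y
    using h01 by (intro G.integrable_const_bound[where B=1] AE_I2) auto
  have hI[measurable]: "(\<lambda>y. \<integral>z'. h i j y z' \<partial>gnoise n) \<in> borel_measurable ?B" for i j
    by (rule G.borel_measurable_lebesgue_integral) (use hm in simp)
  have hI01: "0 \<le> (\<integral>z'. h i j y z' \<partial>gnoise n)" "(\<integral>z'. h i j y z' \<partial>gnoise n) \<le> 1" for i j y
  proof -
    show "0 \<le> (\<integral>z'. h i j y z' \<partial>gnoise n)" using h01 by simp
    have "(\<integral>z'. h i j y z' \<partial>gnoise n) \<le> (\<integral>z'. 1 \<partial>gnoise n)" using ih h01 by (intro integral_mono) auto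
    then show "(\<integral>z'. h i j y z' \<partial>gnoise n) \<le> 1" by (simp add: G.prob_space)
  qed
  define x where "x = (\<lambda>(i, j) t. encB j t + a * encA i t)"
  \<comment> \<open>The mean of the received codeword over all message pairs, as
    \<open>sum_centered_pair_le\<close> requires.\<close>
  define \<mu> where "\<mu> t = (\<Sum>j<MB. encB j t) / real MB + a * ((\<Sum>i<MA. encA i t) / real MA)" for t
  let ?I = "{..<MA} \<times> {..<MB}"
  have "(\<Sum>m\<in>?I. \<integral>z. g m (\<lambda>t\<in>{..<n}. x m t + z t) \<partial>gnoise n) * ln (real (card ?I))
     \<le> real (card ?I) * (real n / 2 * ln (1 + (a\<^sup>2 * PA + PB)) + ln 2)"
  proof (rule gaussian_converse[where \<mu>=\<mu>])
    show "finite ?I" "?I \<noteq> {}" using M by (auto simp: lessThan_empty_iff)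
    show "0 \<le> a\<^sup>2 * PA + PB" using P by simp
    show "g m \<in> borel_measurable ?B" for m
      unfolding g_def by (cases m) auto
    show "0 \<le> g m y" for m y
      using hI01 by (cases m) (auto simp: g_def)
    show "(\<Sum>m\<in>?I. g m y) \<le> 1" for y
    proof -
      have "(\<Sum>i<MA. g (i, j) y) \<le> indicator {y. decB y = j} y" for j
      proof -
        have "(\<Sum>i<MA. g (i, j) y) = indicator {y. decB y = j} y * (\<integral>z'. (\<Sum>i<MA. h i j y z') \<partial>gnoise n)"
          unfolding g_def using ih by (simp add: sum_distrib_left)
        also have "\<dots> \<le> indicator {y. decB y = j} y * (\<integral>z'. 1 \<partial>gnoise n)"
          using ih[unfolded h_def]
          by (intro mult_left_mono integral_mono) (auto simp: h_def intro!: sum_decoding_indicator_le_1)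
        finally show ?thesis by (simp add: G.prob_space)
      qed
      then have "(\<Sum>j<MB. \<Sum>i<MA. g (i, j) y) \<le> (\<Sum>j<MB. indicator {y. decB y = j} y)"
        by (rule sum_mono)
      also have "\<dots> \<le> 1" by (rule sum_decoding_indicator_le_1)
      finally show ?thesis by (subst (asm) sum.swap) (simp add: sum.cartesian_product)
    qed
    have "(\<Sum>m\<in>?I. sqn n (\<lambda>t. x m t - \<mu> t)) = (\<Sum>t<n. \<Sum>i<MA. \<Sum>j<MB. (encB j t + a * encA i t - \<mu> t)\<^sup>2)"
      unfolding sqn_def by (subst sum.swap) (simp add: sum.cartesian_product x_def case_prod_beta')
    also have "\<dots> \<le> (\<Sum>t<n. real MA * (\<Sum>j<MB. (encB j t)\<^sup>2) + a\<^sup>2 * real MB * (\<Sum>i<MA. (encA i t)\<^sup>2))"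
      unfolding \<mu>_def by (intro sum_mono sum_centered_pair_le M)
    also have "\<dots> = real MA * (\<Sum>j<MB. \<Sum>t<n. (encB j t)\<^sup>2) + a\<^sup>2 * real MB * (\<Sum>i<MA. \<Sum>t<n. (encA i t)\<^sup>2)"
      by (simp add: sum.distrib sum_distrib_left[symmetric] sum.swap[of _ "{..<n}"])
    also have "\<dots> \<le> real MA * (\<Sum>j<MB. real n * PB) + a\<^sup>2 * real MB * (\<Sum>i<MA. real n * PA)"
      using pwA pwB by (intro add_mono mult_left_mono sum_mono) (auto simp: power_ok_def)
    finally show "(\<Sum>m\<in>?I. sqn n (\<lambda>t. x m t - \<mu> t)) \<le> real (card ?I) * (real n * (a\<^sup>2 * PA + PB))"
      by (simp add: algebra_simps)
  qed
  moreover have "(\<integral>z. g (i, j) (\<lambda>t\<in>{..<n}. x (i, j) t + z t) \<partial>gnoise n)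
     \<ge> 1 - (err_prob n (\<lambda>t. encA i t + v t) decA i + err_prob n (\<lambda>t. encB j t + a * encA i t) decB j)" for i j
  proof -
    let ?y = "\<lambda>z. \<lambda>t\<in>{..<n}. x (i, j) t + z t"
    let ?p = "\<lambda>z. \<integral>z'. h i j (?y z) z' \<partial>gnoise n"
    have [measurable]: "?y \<in> measurable (gnoise n) ?B" by measurable
    have hy: "h i j (?y z) z' = indicator {y. decA y = i} (\<lambda>t\<in>{..<n}. encA i t + v t + (\<lambda>t\<in>{..<n}. \<alpha> * z t + \<beta> * z' t) t)" for z z'
    proof -
      have "(\<lambda>t\<in>{..<n}. \<alpha> * (?y z t - encB j t) + v t + \<beta> * z' t)
          = (\<lambda>t\<in>{..<n}. encA i t + v t + (\<lambda>t\<in>{..<n}. \<alpha> * z t + \<beta> * z' t) t)"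
      proof (rule restrict_ext)
        fix t assume t: "t \<in> {..<n}"
        have "\<alpha> * (x (i, j) t + z t - encB j t) = (\<alpha> * a) * encA i t + \<alpha> * z t"
          by (simp add: x_def algebra_simps)
        then show "\<alpha> * (?y z t - encB j t) + v t + \<beta> * z' t = encA i t + v t + (\<lambda>t\<in>{..<n}. \<alpha> * z t + \<beta> * z' t) t"
          using t al by simp
      qed
      then show ?thesis unfolding h_def by simp
    qed
    have ipy: "integrable (gnoise n) ?p"
      using hI01 by (intro G.integrable_const_bound[where B=1] AE_I2) auto
    \<comment> \<open>For the transmitted j the imitated output is xA + v + \<alpha> z + \<beta> z',
      which by rotation has the law of A's own output.\<close>
    have Ep: "(\<integral>z. ?p z \<partial>gnoise n) = 1 - err_prob n (\<lambda>t. encA i t + v t) decA i"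
    proof -
      let ?F = "\<lambda>w. ennreal (indicator {y. decA y = i} (\<lambda>t\<in>{..<n}. encA i t + v t + w t))"
      have [measurable]: "?F \<in> borel_measurable ?B" by measurable
      have "ennreal (\<integral>z. ?p z \<partial>gnoise n) = (\<integral>\<^sup>+z. ennreal (?p z) \<partial>gnoise n)"
        using ipy hI01 by (intro nn_integral_eq_integral[symmetric]) auto
      also have "\<dots> = (\<integral>\<^sup>+z. \<integral>\<^sup>+z'. ennreal (h i j (?y z) z') \<partial>gnoise n \<partial>gnoise n)"
        using ih h01 by (intro nn_integral_cong nn_integral_eq_integral[symmetric]) auto
      also have "\<dots> = (\<integral>\<^sup>+z. \<integral>\<^sup>+z'. ?F (\<lambda>t\<in>{..<n}. \<alpha> * z t + \<beta> * z' t) \<partial>gnoise n \<partial>gnoise n)"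
        unfolding hy by simp
      also have "\<dots> = (\<integral>\<^sup>+z. ?F z \<partial>gnoise n)"
        by (rule nn_integral_gnoise_rotation) (use al be in auto)
      also have "\<dots> = ennreal (\<integral>z. indicator {y. decA y = i} (\<lambda>t\<in>{..<n}. encA i t + v t + z t) \<partial>gnoise n)"
        by (intro nn_integral_eq_integral G.integrable_const_bound[where B=1] AE_I2) auto
      finally have "(\<integral>z. ?p z \<partial>gnoise n) = (\<integral>z. indicator {y. decA y = i} (\<lambda>t\<in>{..<n}. encA i t + v t + z t) \<partial>gnoise n)"
        using hI01 by (subst (asm) ennreal_inj) (auto intro!: Bochner_Integration.integral_nonneg)
      then show ?thesis by (simp add: success_prob[OF decA])
    qed
    have iB: "integrable (gnoise n) (\<lambda>z. indicator {y. decB y = j} (?y z) :: real)"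
      by (intro G.integrable_const_bound[where B=1] AE_I2) auto
    have "(1 - err_prob n (\<lambda>t. encA i t + v t) decA i) - err_prob n (\<lambda>t. encB j t + a * encA i t) decB j
      = (\<integral>z. ?p z + indicator {y. decB y = j} (?y z) - 1 \<partial>gnoise n)"
      using ipy iB Ep success_prob[OF decB, of j "\<lambda>t. encB j t + a * encA i t"]
      by (simp add: G.prob_space x_def)
    also have "\<dots> \<le> (\<integral>z. g (i, j) (?y z) \<partial>gnoise n)"
    proof (intro integral_mono)
      show "integrable (gnoise n) (\<lambda>z. ?p z + indicator {y. decB y = j} (?y z) - 1)" using ipy iB by auto
      have gm: "g (i, j) \<in> borel_measurable ?B" unfolding g_def by auto
      then show "integrable (gnoise n) (\<lambda>z. g (i, j) (?y z))"
        using hI01 by (intro G.integrable_const_bound[where B=1] AE_I2)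
          (auto simp: g_def split: split_indicator)
      \<comment> \<open>The union bound pointwise: p d >= p + d - 1 for p at most 1 and d in {0,
        1}.\<close>
      show "?p z + indicator {y. decB y = j} (?y z) - 1 \<le> g (i, j) (?y z)" for z
        using hI01[of i j "?y z"] by (auto simp: g_def split: split_indicator)
    qed
    finally show ?thesis by simp
  qed
  then have "(\<Sum>m\<in>?I. 1 - (err_prob n (\<lambda>t. encA (fst m) t + v t) decA (fst m)
      + err_prob n (\<lambda>t. encB (snd m) t + a * encA (fst m) t) decB (snd m)))
     \<le> (\<Sum>m\<in>?I. \<integral>z. g m (\<lambda>t\<in>{..<n}. x m t + z t) \<partial>gnoise n)"
    by (intro sum_mono) auto
  moreover have "(\<Sum>m\<in>?I. 1 - (err_prob n (\<lambda>t. encA (fst m) t + v t) decA (fst m)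
      + err_prob n (\<lambda>t. encB (snd m) t + a * encA (fst m) t) decB (snd m)))
     = real (MA * MB) - (\<Sum>i<MA. \<Sum>j<MB. err_prob n (\<lambda>t. encA i t + v t) decA i
          + err_prob n (\<lambda>t. encB j t + a * encA i t) decB j)"
    by (simp add: sum_subtractf sum.cartesian_product case_prod_beta')
  moreover have "ln (real (MA * MB)) \<ge> 0"
    using M by (intro ln_ge_zero) (metis One_nat_def Suc_leI nat_0_less_mult_iff of_nat_1 of_nat_le_iff)
  ultimately show ?thesis
    using mult_right_mono by (fastforce simp: card_cartesian_product)
qed

section \<open>From blocklength n to rates, and the converse for the cascade\<close>

text \<open>Division by n ln 2 gives (1 - \<epsilon> n) R <= Cg S + 1/n, where 1/n is what remains
  of the additive ln 2; both corrections vanish in the limit.\<close>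

lemma rate_limit:
  assumes S: "0 \<le> S"
    and M: "\<And>n. 2 powr (real n * R) \<le> M n"
    and bd: "\<And>n. (1 - \<epsilon> n) * ln (M n) \<le> real n / 2 * ln (1 + S) + ln 2"
    and lim: "\<epsilon> \<longlonglongrightarrow> 0"
  shows "R \<le> Cg S"
proof -
  have l1: "(\<lambda>n. (1 - \<epsilon> n) * R) \<longlonglongrightarrow> (1 - 0) * R"
    by (intro tendsto_intros lim)
  have l2: "(\<lambda>n. Cg S + 1 / real n) \<longlonglongrightarrow> Cg S + 0"
    by (intro tendsto_intros lim_1_over_n)
  \<comment> \<open>Only where 1 - \<epsilon> n is positive may the lower bound on ln (M n) be
    multiplied by it.\<close>
  have "\<forall>\<^sub>F n in sequentially. \<epsilon> n < 1"
    using lim by (rule order_tendstoD) simp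
  then have "\<forall>\<^sub>F n in sequentially. (1 - \<epsilon> n) * R \<le> Cg S + 1 / real n"
    using eventually_gt_at_top[of 0]
  proof eventually_elim
    fix n :: nat assume e: "\<epsilon> n < 1" and n: "0 < n"
    have Mp: "M n > 0" using M[of n] by (rule less_le_trans[rotated]) simp
    have "ln (2 powr (real n * R)) \<le> ln (M n)"
      using M[of n] Mp by (subst ln_le_cancel_iff) auto
    then have "(1 - \<epsilon> n) * (real n * R * ln 2) \<le> (1 - \<epsilon> n) * ln (M n)"
      using e by (intro mult_left_mono) (auto simp: ln_powr)
    also note bd
    also have "real n / 2 * ln (1 + S) + ln 2 = (Cg S + 1 / real n) * (real n * ln 2)"
      using n by (simp add: Cg_def log_def field_simps)
    finally have "((1 - \<epsilon> n) * R) * (real n * ln 2) \<le> (Cg S + 1 / real n) * (real n * ln 2)"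
      by (simp add: mult_ac)
    then show "(1 - \<epsilon> n) * R \<le> Cg S + 1 / real n"
      using n by (subst (asm) mult_le_cancel_right_pos) auto
  qed
  then show ?thesis
    using tendsto_le[OF _ l2 l1] by simp
qed

lemma avg_err_bound:
  assumes "0 < real (M1 * M2 * M3)"
    and "(real (M1 * M2 * M3) - (\<Sum>m1<M1. \<Sum>m2<M2. \<Sum>m3<M3. err_prob n (sig m1 m2 m3) dec (sel m1 m2 m3)
        + err_prob n (sig' m1 m2 m3) dec' (sel' m1 m2 m3))) * l \<le> real (M1 * M2 * M3) * K"
  shows "(1 - (avg_err n M1 M2 M3 sig dec sel + avg_err n M1 M2 M3 sig' dec' sel')) * l \<le> K"
proof -
  let ?N = "real (M1 * M2 * M3)"
  have "?N * ((1 - (avg_err n M1 M2 M3 sig dec sel + avg_err n M1 M2 M3 sig' dec' sel')) * l) \<le> ?N * K"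
    using assms by (simp add: avg_err_def sum.distrib field_simps)
  then show ?thesis using assms(1) by (simp only: mult_le_cancel_left_pos)
qed

lemma avg_err_bound1:
  assumes "0 < real (M1 * M2 * M3)"
    and "(real (M1 * M2 * M3) - (\<Sum>m1<M1. \<Sum>m2<M2. \<Sum>m3<M3. err_prob n (sig m1 m2 m3) dec (sel m1 m2 m3))) * l
       \<le> real (M1 * M2 * M3) * K"
  shows "(1 - avg_err n M1 M2 M3 sig dec sel) * l \<le> K"
proof -
  let ?N = "real (M1 * M2 * M3)"
  have "?N * ((1 - avg_err n M1 M2 M3 sig dec sel) * l) \<le> ?N * K"
    using assms by (simp add: avg_err_def field_simps)
  then show ?thesis using assms(1) by (simp only: mult_le_cancel_left_pos)
qed

lemma cgzic_converse:
  assumes P: "P1 > 0" "P2 > 0" "P3 > 0" and a: "1 \<le> a1" "1 \<le> a2"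
    and ach: "(R1, R2, R3) \<in> cgzic_achievable a1 a2 P1 P2 P3"
  shows "0 \<le> R1 \<and> 0 \<le> R2 \<and> 0 \<le> R3 \<and> R1 \<le> Cg P1 \<and> R2 \<le> Cg P2 \<and> R3 \<le> Cg P3 \<and>
    R1 + R2 \<le> Cg (a1\<^sup>2 * P1 + P2) \<and> R2 + R3 \<le> Cg (a2\<^sup>2 * P2 + P3)"
proof -
  obtain M1 M2 M3 :: "nat \<Rightarrow> nat" and e1 e2 e3 :: "nat \<Rightarrow> nat \<Rightarrow> nat \<Rightarrow> real" and d1 d2 d3
    where R: "0 \<le> R1" "0 \<le> R2" "0 \<le> R3" and
      M: "\<And>n. 2 powr (real n * R1) \<le> real (M1 n)" "\<And>n. 2 powr (real n * R2) \<le> real (M2 n)"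
         "\<And>n. 2 powr (real n * R3) \<le> real (M3 n)" and
      pw: "\<And>n. power_ok n P1 (M1 n) (e1 n)" "\<And>n. power_ok n P2 (M2 n) (e2 n)" "\<And>n. power_ok n P3 (M3 n) (e3 n)" and
      dc: "\<And>n. decoder_ok n (d1 n)" "\<And>n. decoder_ok n (d2 n)" "\<And>n. decoder_ok n (d3 n)" and
      l1: "(\<lambda>n. avg_err n (M1 n) (M2 n) (M3 n) (\<lambda>m1 m2 m3. e1 n m1) (d1 n) (\<lambda>m1 m2 m3. m1)) \<longlonglongrightarrow> 0" and
      l2: "(\<lambda>n. avg_err n (M1 n) (M2 n) (M3 n) (\<lambda>m1 m2 m3 t. e2 n m2 t + a1 * e1 n m1 t) (d2 n)
              (\<lambda>m1 m2 m3. m2)) \<longlonglongrightarrow> 0" and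
      l3: "(\<lambda>n. avg_err n (M1 n) (M2 n) (M3 n) (\<lambda>m1 m2 m3 t. e3 n m3 t + a2 * e2 n m2 t) (d3 n)
              (\<lambda>m1 m2 m3. m3)) \<longlonglongrightarrow> 0"
    using ach unfolding cgzic_achievable_def by blast
  have "k > 0" if "2 powr r \<le> real k" for r k
    using less_le_trans[OF _ that, of 0] by simp
  then have Mp: "M1 n > 0" "M2 n > 0" "M3 n > 0" for n
    using M[of n] by blast+
  have N: "0 < real (M1 n * M2 n * M3 n)" for n using Mp[of n] by simp
  have "R1 \<le> Cg P1"
  proof (rule rate_limit[OF _ M(1) _ l1])
    fix n
    let ?K = "real n / 2 * ln (1 + P1) + ln 2"
    show "(1 - avg_err n (M1 n) (M2 n) (M3 n) (\<lambda>m1 m2 m3. e1 n m1) (d1 n) (\<lambda>m1 m2 m3. m1)) * ln (real (M1 n)) \<le> ?K"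
    proof (rule avg_err_bound1[OF N])
      have "real (M2 n * M3 n) * ((real (M1 n) - (\<Sum>m<M1 n. err_prob n (\<lambda>t. e1 n m t + 0) (d1 n) m)) * ln (real (M1 n)))
         \<le> real (M2 n * M3 n) * (real (M1 n) * ?K)"
        using P by (intro mult_left_mono point_to_point_converse Mp pw dc) auto
      then show "(real (M1 n * M2 n * M3 n) - (\<Sum>m1<M1 n. \<Sum>m2<M2 n. \<Sum>m3<M3 n. err_prob n (e1 n m1) (d1 n) m1)) * ln (real (M1 n))
         \<le> real (M1 n * M2 n * M3 n) * ?K"
        by (simp add: sum_distrib_left sum_distrib_right algebra_simps)
    qed
  qed (use P in auto)
  moreover have "R2 \<le> Cg P2"
  proof (rule rate_limit[OF _ M(2) _ l2])
    fix n
    let ?K = "real n / 2 * ln (1 + P2) + ln 2"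
    show "(1 - avg_err n (M1 n) (M2 n) (M3 n) (\<lambda>m1 m2 m3 t. e2 n m2 t + a1 * e1 n m1 t) (d2 n) (\<lambda>m1 m2 m3. m2)) * ln (real (M2 n)) \<le> ?K"
    proof (rule avg_err_bound1[OF N])
      \<comment> \<open>For each \<open>m1\<close> the interference \<open>a1 * e1 n m1\<close> is a
        constant shift. The factor \<open>M3 n\<close> counts equal terms, as the third message does
        not reach receiver 2.\<close>
      have "real (M3 n) * (\<Sum>m1<M1 n. (real (M2 n) - (\<Sum>m<M2 n. err_prob n (\<lambda>t. e2 n m t + a1 * e1 n m1 t) (d2 n) m)) * ln (real (M2 n)))
         \<le> real (M3 n) * (\<Sum>m1<M1 n. real (M2 n) * ?K)"
        using P by (intro mult_left_mono sum_mono point_to_point_converse Mp pw dc) auto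
      then show "(real (M1 n * M2 n * M3 n) - (\<Sum>m1<M1 n. \<Sum>m2<M2 n. \<Sum>m3<M3 n.
            err_prob n (\<lambda>t. e2 n m2 t + a1 * e1 n m1 t) (d2 n) m2)) * ln (real (M2 n))
         \<le> real (M1 n * M2 n * M3 n) * ?K"
        by (simp add: sum_distrib_left sum_distrib_right sum_subtractf algebra_simps)
    qed
  qed (use P in auto)
  moreover have "R3 \<le> Cg P3"
  proof (rule rate_limit[OF _ M(3) _ l3])
    fix n
    let ?K = "real n / 2 * ln (1 + P3) + ln 2"
    show "(1 - avg_err n (M1 n) (M2 n) (M3 n) (\<lambda>m1 m2 m3 t. e3 n m3 t + a2 * e2 n m2 t) (d3 n) (\<lambda>m1 m2 m3. m3)) * ln (real (M3 n)) \<le> ?K"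
    proof (rule avg_err_bound1[OF N])
      have "real (M1 n) * (\<Sum>m2<M2 n. (real (M3 n) - (\<Sum>m<M3 n. err_prob n (\<lambda>t. e3 n m t + a2 * e2 n m2 t) (d3 n) m)) * ln (real (M3 n)))
         \<le> real (M1 n) * (\<Sum>m2<M2 n. real (M3 n) * ?K)"
        using P by (intro mult_left_mono sum_mono point_to_point_converse Mp pw dc) auto
      then show "(real (M1 n * M2 n * M3 n) - (\<Sum>m1<M1 n. \<Sum>m2<M2 n. \<Sum>m3<M3 n.
            err_prob n (\<lambda>t. e3 n m3 t + a2 * e2 n m2 t) (d3 n) m3)) * ln (real (M3 n))
         \<le> real (M1 n * M2 n * M3 n) * ?K"
        by (simp add: sum_distrib_left sum_distrib_right sum_subtractf algebra_simps)
    qed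
  qed (use P in auto)
  moreover have "R1 + R2 \<le> Cg (a1\<^sup>2 * P1 + P2)"
  proof (rule rate_limit[where M="\<lambda>n. real (M1 n * M2 n)"])
    show "0 \<le> a1\<^sup>2 * P1 + P2" using P by simp
    show "2 powr (real n * (R1 + R2)) \<le> real (M1 n * M2 n)" for n
      using mult_mono[OF M(1)[of n] M(2)[of n]] by (simp add: powr_add algebra_simps)
    show "(\<lambda>n. avg_err n (M1 n) (M2 n) (M3 n) (\<lambda>m1 m2 m3. e1 n m1) (d1 n) (\<lambda>m1 m2 m3. m1) +
        avg_err n (M1 n) (M2 n) (M3 n) (\<lambda>m1 m2 m3 t. e2 n m2 t + a1 * e1 n m1 t) (d2 n) (\<lambda>m1 m2 m3. m2)) \<longlonglongrightarrow> 0"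
      using tendsto_add[OF l1 l2] by simp
    fix n
    let ?K = "real n / 2 * ln (1 + (a1\<^sup>2 * P1 + P2)) + ln 2"
    show "(1 - (avg_err n (M1 n) (M2 n) (M3 n) (\<lambda>m1 m2 m3. e1 n m1) (d1 n) (\<lambda>m1 m2 m3. m1) +
        avg_err n (M1 n) (M2 n) (M3 n) (\<lambda>m1 m2 m3 t. e2 n m2 t + a1 * e1 n m1 t) (d2 n) (\<lambda>m1 m2 m3. m2)))
        * ln (real (M1 n * M2 n)) \<le> ?K"
    proof (rule avg_err_bound[OF N])
      have "real (M3 n) * ((real (M1 n * M2 n) - (\<Sum>i<M1 n. \<Sum>j<M2 n. err_prob n (\<lambda>t. e1 n i t + 0) (d1 n) i
          + err_prob n (\<lambda>t. e2 n j t + a1 * e1 n i t) (d2 n) j)) * ln (real (M1 n * M2 n)))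
          \<le> real (M3 n) * (real (M1 n * M2 n) * ?K)"
        using P a by (intro mult_left_mono z_channel_converse Mp pw dc) auto
      then show "(real (M1 n * M2 n * M3 n) - (\<Sum>m1<M1 n. \<Sum>m2<M2 n. \<Sum>m3<M3 n. err_prob n (e1 n m1) (d1 n) m1
          + err_prob n (\<lambda>t. e2 n m2 t + a1 * e1 n m1 t) (d2 n) m2)) * ln (real (M1 n * M2 n))
          \<le> real (M1 n * M2 n * M3 n) * ?K"
        by (simp add: sum_distrib_left sum_distrib_right sum.distrib algebra_simps)
    qed
  qed
  moreover have "R2 + R3 \<le> Cg (a2\<^sup>2 * P2 + P3)"
  proof (rule rate_limit[where M="\<lambda>n. real (M2 n * M3 n)"])
    show "0 \<le> a2\<^sup>2 * P2 + P3" using P by simp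
    show "2 powr (real n * (R2 + R3)) \<le> real (M2 n * M3 n)" for n
      using mult_mono[OF M(2)[of n] M(3)[of n]] by (simp add: powr_add algebra_simps)
    show "(\<lambda>n. avg_err n (M1 n) (M2 n) (M3 n) (\<lambda>m1 m2 m3 t. e2 n m2 t + a1 * e1 n m1 t) (d2 n) (\<lambda>m1 m2 m3. m2) +
        avg_err n (M1 n) (M2 n) (M3 n) (\<lambda>m1 m2 m3 t. e3 n m3 t + a2 * e2 n m2 t) (d3 n) (\<lambda>m1 m2 m3. m3)) \<longlonglongrightarrow> 0"
      using tendsto_add[OF l2 l3] by simp
    fix n
    let ?K = "real n / 2 * ln (1 + (a2\<^sup>2 * P2 + P3)) + ln 2"
    show "(1 - (avg_err n (M1 n) (M2 n) (M3 n) (\<lambda>m1 m2 m3 t. e2 n m2 t + a1 * e1 n m1 t) (d2 n) (\<lambda>m1 m2 m3. m2) +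
        avg_err n (M1 n) (M2 n) (M3 n) (\<lambda>m1 m2 m3 t. e3 n m3 t + a2 * e2 n m2 t) (d3 n) (\<lambda>m1 m2 m3. m3)))
        * ln (real (M2 n * M3 n)) \<le> ?K"
    proof (rule avg_err_bound[OF N])
      \<comment> \<open>The link 2 -> 3 for fixed \<open>m1\<close>: receiver 2 has v =
        \<open>a1 * e1 n m1\<close>, whereas receiver 3 does not hear user 1. The bound holds for
        every \<open>m1\<close> and is then summed.\<close>
      have "(\<Sum>m1<M1 n. (real (M2 n * M3 n) - (\<Sum>i<M2 n. \<Sum>j<M3 n. err_prob n (\<lambda>t. e2 n i t + a1 * e1 n m1 t) (d2 n) i
          + err_prob n (\<lambda>t. e3 n j t + a2 * e2 n i t) (d3 n) j)) * ln (real (M2 n * M3 n)))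
          \<le> (\<Sum>m1<M1 n. real (M2 n * M3 n) * ?K)"
        using P a by (intro sum_mono z_channel_converse Mp pw dc) auto
      then show "(real (M1 n * M2 n * M3 n) - (\<Sum>m1<M1 n. \<Sum>m2<M2 n. \<Sum>m3<M3 n.
          err_prob n (\<lambda>t. e2 n m2 t + a1 * e1 n m1 t) (d2 n) m2
          + err_prob n (\<lambda>t. e3 n m3 t + a2 * e2 n m2 t) (d3 n) m3)) * ln (real (M2 n * M3 n))
          \<le> real (M1 n * M2 n * M3 n) * ?K"
        by (simp add: sum_distrib_right[symmetric] sum_distrib_left[symmetric] sum_subtractf algebra_simps)
    qed
  qed
  ultimately show ?thesis using R by blast
qed

section \<open>Random Gaussian codebooks\<close>

text \<open>The unscaled codeword of message m of user i is the value at (i, m).\<close>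
definition codebook :: "nat \<Rightarrow> (nat \<times> nat \<Rightarrow> nat \<Rightarrow> real) measure" where
  "codebook n = PiM UNIV (\<lambda>_. gnoise n)"

lemma prob_space_codebook: "prob_space (codebook n)"
  unfolding codebook_def by (intro prob_space_PiM prob_space_gnoise)

lemma codeword_measurable [measurable]: "(\<lambda>\<omega>. \<omega> k) \<in> measurable (codebook n) (gnoise n)"
  unfolding codebook_def by measurable

lemma codeword_component_measurable:
  "t < n \<Longrightarrow> (\<lambda>\<omega>. \<omega> k t) \<in> borel_measurable (codebook n)"
  "t < n \<Longrightarrow> (\<lambda>p. fst p k t) \<in> borel_measurable (codebook n \<Otimes>\<^sub>M gnoise n)"
  "t < n \<Longrightarrow> (\<lambda>p. snd p t) \<in> borel_measurable (codebook n \<Otimes>\<^sub>M gnoise n)"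
proof -
  assume t: "t < n"
  then have m: "(\<lambda>z. z t) \<in> borel_measurable (gnoise n)" by simp
  show "(\<lambda>\<omega>. \<omega> k t) \<in> borel_measurable (codebook n)"
    by (rule measurable_compose[OF codeword_measurable m])
  then show "(\<lambda>p. fst p k t) \<in> borel_measurable (codebook n \<Otimes>\<^sub>M gnoise n)"
    by (rule measurable_compose[OF measurable_fst])
  show "(\<lambda>p. snd p t) \<in> borel_measurable (codebook n \<Otimes>\<^sub>M gnoise n)"
    by (rule measurable_compose[OF measurable_snd m])
qed

lemma borel_measurable_sqn [measurable (raw)]:
  assumes "\<And>t. t < n \<Longrightarrow> (\<lambda>\<omega>. f \<omega> t) \<in> borel_measurable M"
  shows "(\<lambda>\<omega>. sqn n (\<lambda>t. f \<omega> t)) \<in> borel_measurable M"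
  unfolding sqn_def using assms by (intro borel_measurable_sum) auto

lemmas signal_measurable = borel_measurable_sqn borel_measurable_add borel_measurable_diff
  borel_measurable_times borel_measurable_const codeword_component_measurable

text \<open>Fubini for a single codeword: coordinate k is integrated out while the others stay
  fixed. \<open>H\<close> is the conditional expectation; in the applications it is again the
  exponential of a quadratic form, so codewords can be removed one after another. Every pair of
  naturals indexes a codeword, whatever the code sizes are.\<close>

lemma nn_integral_codebook_resample:
  assumes F[measurable]: "F \<in> borel_measurable (codebook n)"
    and H: "\<And>\<omega>. \<omega> \<in> space (codebook n) \<Longrightarrow> (\<integral>\<^sup>+w. F (fun_upd \<omega> k w) \<partial>gnoise n) = H \<omega>"
  shows "(\<integral>\<^sup>+\<omega>. F \<omega> \<partial>codebook n) = (\<integral>\<^sup>+\<omega>. H \<omega> \<partial>codebook n)"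
proof -
  let ?X = "PiM (UNIV - {k}) (\<lambda>_. gnoise n)"
  let ?U = "\<lambda>(x, X). fun_upd X k x"
  interpret G: prob_space "gnoise n" by (rule prob_space_gnoise)
  interpret X: prob_space ?X by (intro prob_space_PiM prob_space_gnoise)
  interpret GX: pair_prob_space "gnoise n" ?X ..
  have ins: "insert k (UNIV - {k}) = UNIV" by auto
  have d: "distr (gnoise n \<Otimes>\<^sub>M ?X) (codebook n) ?U = codebook n"
    using distr_pair_PiM_eq_PiM[of "UNIV - {k}" "\<lambda>_. gnoise n" k] prob_space_gnoise
    unfolding ins codebook_def by auto
  have U[measurable]: "?U \<in> measurable (gnoise n \<Otimes>\<^sub>M ?X) (codebook n)"
    unfolding codebook_def case_prod_beta'
    using measurable_fun_upd[where I="UNIV" and J="UNIV - {k}" and i=k] ins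
    by (intro measurable_fun_upd[where J="UNIV - {k}"]) auto
  have U': "(\<lambda>(\<omega>, w). fun_upd \<omega> k w) \<in> measurable (codebook n \<Otimes>\<^sub>M gnoise n) (codebook n)"
    unfolding codebook_def case_prod_beta'
    by (intro measurable_fun_upd[where J="UNIV"]) auto
  have Fm[measurable]: "(\<lambda>(\<omega>, w). F (fun_upd \<omega> k w)) \<in> borel_measurable (codebook n \<Otimes>\<^sub>M gnoise n)"
    using measurable_compose[OF U' F] by (simp add: case_prod_beta')
  have int: "(\<integral>\<^sup>+\<omega>. f \<omega> \<partial>codebook n) = (\<integral>\<^sup>+X. \<integral>\<^sup>+x. f (fun_upd X k x) \<partial>gnoise n \<partial>?X)"
    if [measurable]: "f \<in> borel_measurable (codebook n)" for f :: "_ \<Rightarrow> ennreal"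
  proof -
    have "(\<integral>\<^sup>+\<omega>. f \<omega> \<partial>codebook n) = (\<integral>\<^sup>+p. f (?U p) \<partial>(gnoise n \<Otimes>\<^sub>M ?X))"
      by (subst d[symmetric], subst nn_integral_distr) auto
    also have "\<dots> = (\<integral>\<^sup>+X. \<integral>\<^sup>+x. f (fun_upd X k x) \<partial>gnoise n \<partial>?X)"
      by (subst GX.nn_integral_snd[symmetric]) auto
    finally show ?thesis .
  qed
  have Hm: "(\<lambda>\<omega>. \<integral>\<^sup>+w. F (fun_upd \<omega> k w) \<partial>gnoise n) \<in> borel_measurable (codebook n)"
    by measurable
  have "(\<integral>\<^sup>+\<omega>. H \<omega> \<partial>codebook n) = (\<integral>\<^sup>+\<omega>. \<integral>\<^sup>+w. F (fun_upd \<omega> k w) \<partial>gnoise n \<partial>codebook n)"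
    by (intro nn_integral_cong) (simp add: H)
  also have "\<dots> = (\<integral>\<^sup>+X. \<integral>\<^sup>+x. \<integral>\<^sup>+w. F (fun_upd (fun_upd X k x) k w) \<partial>gnoise n \<partial>gnoise n \<partial>?X)"
    by (rule int[OF Hm])
  \<comment> \<open>The inner update overwrites the value drawn outside, so the outer integral is
    that of a constant over a probability space.\<close>
  also have "\<dots> = (\<integral>\<^sup>+X. \<integral>\<^sup>+w. F (fun_upd X k w) \<partial>gnoise n \<partial>?X)"
    by (simp add: G.emeasure_space_1)
  also have "\<dots> = (\<integral>\<^sup>+\<omega>. F \<omega> \<partial>codebook n)" by (rule int[OF F, symmetric])
  finally show ?thesis by simp
qed

section \<open>Chernoff exponents and Gaussian expectations over the codebook\<close>

text \<open>Both tails at once: \<open>s\<close> has the sign of V - T, and the last inequality says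
  that the Chernoff exponent for squared norm n T of a Gaussian vector of variance V per symbol is
  negative.\<close>

lemma chernoff_rate:
  fixes V T :: real
  assumes V: "V > 0" and T: "T > 0" "T \<noteq> V"
  obtains s where "(V - T) * s > 0" "1 + 2 * s * V > 0" "s * T < ln (1 + 2 * s * V) / 2"
proof
  \<comment> \<open>At the optimum 1 + 2 s V = V / T the estimate ln x >= 1 - 1/x yields only that
    the exponent is at most zero. The value 2 V / (V + T), closer to one, makes the same estimate
    strict.\<close>
  define q where "q = (V - T) / (V + T)"
  define s where "s = q / (2 * V)"
  have "2 * s * V = (V - T) / (V + T)" unfolding q_def[symmetric] using V by (simp add: s_def)
  then have x: "1 + 2 * s * V = 2 * V / (V + T)" using V T by (simp add: field_simps)
  then show pos: "1 + 2 * s * V > 0" using V T by simp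
  have "(V - T) * s = (V - T)\<^sup>2 / ((V + T) * (2 * V))" by (simp add: s_def q_def power2_eq_square)
  then show sg: "(V - T) * s > 0" using V T by simp
  have "ln (1 / (1 + 2 * s * V)) \<le> 1 / (1 + 2 * s * V) - 1"
    using pos by (intro ln_le_minus_one) simp
  then have "- ln (1 + 2 * s * V) \<le> 1 / (1 + 2 * s * V) - 1"
    using pos by (simp add: ln_div)
  also have "1 / (1 + 2 * s * V) - 1 = (T - V) / (2 * V)" unfolding x using V T by (simp add: field_simps)
  also have "(T - V) / (2 * V) = - 2 * ((V - T) / (4 * V))" using V by (simp add: field_simps)
  finally have "ln (1 + 2 * s * V) / 2 \<ge> (V - T) / (4 * V)" by linarith
  moreover have "s * T < (V - T) / (4 * V)"
  proof -
    have "q * (V + T) = V - T" using V T by (simp add: q_def)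
    moreover have "q * (V - T) > 0"
      using V T by (simp add: q_def power2_eq_square[symmetric])
    ultimately have "2 * q * T < V - T" by (simp add: algebra_simps)
    then have "2 * q * T / (4 * V) < (V - T) / (4 * V)" using V by (intro divide_strict_right_mono) auto
    then show ?thesis by (simp add: s_def mult.commute)
  qed
  ultimately show "s * T < ln (1 + 2 * s * V) / 2" by linarith
qed

text \<open>The map x -> 1 + 2 s x is affine with value 1 at 0, and c^2 lies between 0 and V. So
  positivity at the total variance covers each partial one.\<close>

lemma gaussian_sum_pos:
  fixes s c V :: real
  assumes "0 < 1 + 2 * s * V" "c\<^sup>2 \<le> V"
  shows "0 < 1 + 2 * s * c\<^sup>2"
proof (cases "s \<ge> 0")
  case True
  then have "0 \<le> s * c\<^sup>2" by simp
  then show ?thesis by linarith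
next
  case False
  then have "s * V \<le> s * c\<^sup>2" using assms by (intro mult_left_mono_neg) auto
  then show ?thesis using assms by linarith
qed


text \<open>The normalising factor is kept in the exponent: one integration maps exp (K - s |.|^2)
  to the same shape with new K and s, which is what lets the integrations be chained.\<close>

lemma nn_integral_gnoise_exp_quadratic:
  assumes D: "0 < 1 + 2 * s * c\<^sup>2"
  shows "(\<integral>\<^sup>+w. ennreal (exp (K - s * sqn n (\<lambda>t. y t + c * w t))) \<partial>gnoise n)
    = ennreal (exp (K - real n / 2 * ln (1 + 2 * s * c\<^sup>2) - s / (1 + 2 * s * c\<^sup>2) * sqn n y))"
proof -
  let ?D = "1 + 2 * s * c\<^sup>2"
  have r: "exp (- (real n / 2 * ln ?D)) = (1 / sqrt ?D) ^ n"
  proof -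
    have "1 / sqrt ?D = exp (- (1 / 2 * ln ?D))"
      using D by (simp add: exp_minus inverse_eq_divide ln_sqrt[symmetric])
    then show ?thesis by (simp add: exp_of_nat_mult[symmetric])
  qed
  have e: "exp (K - real n / 2 * ln ?D - s / ?D * sqn n y) = exp K * (exp (- s / ?D * sqn n y) * (1 / sqrt ?D) ^ n)"
    unfolding r[symmetric] mult_exp_exp by (simp add: algebra_simps)
  have "(\<integral>\<^sup>+w. ennreal (exp (K - s * sqn n (\<lambda>t. y t + c * w t))) \<partial>gnoise n)
     = (\<integral>\<^sup>+w. ennreal (exp K) * ennreal (exp (- s * sqn n (\<lambda>t. y t + c * w t))) \<partial>gnoise n)"
    by (simp add: ennreal_mult'[symmetric] mult_exp_exp)
  also have "\<dots> = ennreal (exp K) * (\<integral>\<^sup>+w. ennreal (exp (- s * sqn n (\<lambda>t. y t + c * w t))) \<partial>gnoise n)"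
    by (rule nn_integral_cmult) measurable
  also have "\<dots> = ennreal (exp (K - real n / 2 * ln ?D - s / ?D * sqn n y))"
    unfolding nn_integral_gnoise_exp_sqn[OF D] e by (simp add: ennreal_mult')
  finally show ?thesis .
qed

text \<open>Integrating out a Gaussian of variance c^2 replaces s by s / (1 + 2 s c^2), which telescopes.\<close>
lemma gaussian_telescope:
  fixes s c V :: real
  assumes c: "0 < 1 + 2 * s * c\<^sup>2" and V: "0 < 1 + 2 * s * (c\<^sup>2 + V)"
  shows "0 < 1 + 2 * (s / (1 + 2 * s * c\<^sup>2)) * V"
    and "ln (1 + 2 * s * c\<^sup>2) + ln (1 + 2 * (s / (1 + 2 * s * c\<^sup>2)) * V) = ln (1 + 2 * s * (c\<^sup>2 + V))"
    and "s / (1 + 2 * s * c\<^sup>2) / (1 + 2 * (s / (1 + 2 * s * c\<^sup>2)) * V) = s / (1 + 2 * s * (c\<^sup>2 + V))"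
proof -
  have *: "1 + 2 * (s / (1 + 2 * s * c\<^sup>2)) * V = (1 + 2 * s * (c\<^sup>2 + V)) / (1 + 2 * s * c\<^sup>2)"
    using c by (simp add: field_simps)
  show "0 < 1 + 2 * (s / (1 + 2 * s * c\<^sup>2)) * V" unfolding * using c V by simp
  show "ln (1 + 2 * s * c\<^sup>2) + ln (1 + 2 * (s / (1 + 2 * s * c\<^sup>2)) * V) = ln (1 + 2 * s * (c\<^sup>2 + V))"
    unfolding * using c V by (simp add: ln_div)
  show "s / (1 + 2 * s * c\<^sup>2) / (1 + 2 * (s / (1 + 2 * s * c\<^sup>2)) * V) = s / (1 + 2 * s * (c\<^sup>2 + V))"
    unfolding * using c by simp
qed

lemma nn_integral_codeword_exp:
  assumes "0 < 1 + 2 * s * c\<^sup>2"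
  shows "(\<integral>\<^sup>+\<omega>. ennreal (exp (K - s * sqn n (\<lambda>t. c * \<omega> k t))) \<partial>codebook n)
    = ennreal (exp (K - real n / 2 * ln (1 + 2 * s * c\<^sup>2)))"
proof -
  interpret prob_space "codebook n" by (rule prob_space_codebook)
  have "(\<integral>\<^sup>+\<omega>. ennreal (exp (K - s * sqn n (\<lambda>t. c * \<omega> k t))) \<partial>codebook n)
      = (\<integral>\<^sup>+\<omega>. ennreal (exp (K - real n / 2 * ln (1 + 2 * s * c\<^sup>2))) \<partial>codebook n)"
  proof (rule nn_integral_codebook_resample)
    have [measurable]: "(\<lambda>\<omega>. sqn n (\<lambda>t. c * \<omega> k t)) \<in> borel_measurable (codebook n)"
      by (intro signal_measurable)
    show "(\<lambda>\<omega>. ennreal (exp (K - s * sqn n (\<lambda>t. c * \<omega> k t)))) \<in> borel_measurable (codebook n)"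
      by measurable
    show "(\<integral>\<^sup>+w. ennreal (exp (K - s * sqn n (\<lambda>t. c * (fun_upd \<omega> k w) k t))) \<partial>gnoise n)
        = ennreal (exp (K - real n / 2 * ln (1 + 2 * s * c\<^sup>2)))" for \<omega>
      using nn_integral_gnoise_exp_quadratic[OF assms, where K=K and n=n and y="\<lambda>_. 0"] by (simp add: sqn_def)
  qed
  then show ?thesis by (simp add: emeasure_space_1)
qed

text \<open>The received vector has variance 1 + c^2 + d^2 per symbol. Noise, codeword l and
  codeword k are integrated out in this order, and the logarithms telescope to that of the
  total.\<close>

lemma nn_integral_received_exp:
  assumes pos: "0 < 1 + 2 * s * (1 + c\<^sup>2 + d\<^sup>2)" and k: "k \<noteq> l"
  shows "(\<integral>\<^sup>+\<omega>. \<integral>\<^sup>+z. ennreal (exp (K - s * sqn n (\<lambda>t. c * \<omega> k t + d * \<omega> l t + z t))) \<partial>gnoise n \<partial>codebook n)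
     = ennreal (exp (K - real n / 2 * ln (1 + 2 * s * (1 + c\<^sup>2 + d\<^sup>2))))"
proof -
  let ?s1 = "s / (1 + 2 * s * 1\<^sup>2)"
  let ?s2 = "?s1 / (1 + 2 * ?s1 * d\<^sup>2)"
  have p1: "0 < 1 + 2 * s * 1\<^sup>2" using gaussian_sum_pos[OF pos, of 1] by simp
  have q1: "0 < 1 + 2 * s * (1\<^sup>2 + (d\<^sup>2 + c\<^sup>2))" using pos by (simp add: algebra_simps)
  note t1 = gaussian_telescope[OF p1 q1]
  have p2: "0 < 1 + 2 * ?s1 * d\<^sup>2" using gaussian_sum_pos[OF t1(1), of d] by simp
  note t2 = gaussian_telescope[OF p2 t1(1)]
  have "(\<integral>\<^sup>+z. ennreal (exp (K - s * sqn n (\<lambda>t. c * \<omega> k t + d * \<omega> l t + z t))) \<partial>gnoise n)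
     = ennreal (exp (K - real n / 2 * ln (1 + 2 * s * 1\<^sup>2) - ?s1 * sqn n (\<lambda>t. c * \<omega> k t + d * \<omega> l t)))" for \<omega>
    using nn_integral_gnoise_exp_quadratic[OF p1, where K=K and n=n and y="\<lambda>t. c * \<omega> k t + d * \<omega> l t"] by simp
  then have "(\<integral>\<^sup>+\<omega>. \<integral>\<^sup>+z. ennreal (exp (K - s * sqn n (\<lambda>t. c * \<omega> k t + d * \<omega> l t + z t))) \<partial>gnoise n \<partial>codebook n)
    = (\<integral>\<^sup>+\<omega>. ennreal (exp (K - real n / 2 * ln (1 + 2 * s * 1\<^sup>2) - ?s1 * sqn n (\<lambda>t. c * \<omega> k t + d * \<omega> l t))) \<partial>codebook n)"
    by simp
  also have "\<dots> = (\<integral>\<^sup>+\<omega>. ennreal (exp (K - real n / 2 * ln (1 + 2 * s * 1\<^sup>2) - real n / 2 * ln (1 + 2 * ?s1 * d\<^sup>2)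
      - ?s2 * sqn n (\<lambda>t. c * \<omega> k t))) \<partial>codebook n)"
  proof (rule nn_integral_codebook_resample)
    have [measurable]: "(\<lambda>\<omega>. sqn n (\<lambda>t. c * \<omega> k t + d * \<omega> l t)) \<in> borel_measurable (codebook n)"
      by (intro signal_measurable)
    show "(\<lambda>\<omega>. ennreal (exp (K - real n / 2 * ln (1 + 2 * s * 1\<^sup>2)
      - ?s1 * sqn n (\<lambda>t. c * \<omega> k t + d * \<omega> l t)))) \<in> borel_measurable (codebook n)"
      by measurable
    fix \<omega> :: "nat \<times> nat \<Rightarrow> nat \<Rightarrow> real"
    show "(\<integral>\<^sup>+w. ennreal (exp (K - real n / 2 * ln (1 + 2 * s * 1\<^sup>2)
          - ?s1 * sqn n (\<lambda>t. c * (fun_upd \<omega> l w) k t + d * (fun_upd \<omega> l w) l t))) \<partial>gnoise n)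
       = ennreal (exp (K - real n / 2 * ln (1 + 2 * s * 1\<^sup>2) - real n / 2 * ln (1 + 2 * ?s1 * d\<^sup>2)
          - ?s2 * sqn n (\<lambda>t. c * \<omega> k t)))"
      using nn_integral_gnoise_exp_quadratic[OF p2, where K="K - real n / 2 * ln (1 + 2 * s * 1\<^sup>2)" and n=n and y="\<lambda>t. c * \<omega> k t"] k
      by simp
  qed
  also have "\<dots> = ennreal (exp (K - real n / 2 * ln (1 + 2 * s * 1\<^sup>2) - real n / 2 * ln (1 + 2 * ?s1 * d\<^sup>2)
      - real n / 2 * ln (1 + 2 * ?s2 * c\<^sup>2)))"
    by (rule nn_integral_codeword_exp) (rule t2(1))
  also have "K - real n / 2 * ln (1 + 2 * s * 1\<^sup>2) - real n / 2 * ln (1 + 2 * ?s1 * d\<^sup>2)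
      - real n / 2 * ln (1 + 2 * ?s2 * c\<^sup>2) = K - real n / 2 * ln (1 + 2 * s * (1\<^sup>2 + (d\<^sup>2 + c\<^sup>2)))"
    unfolding t1(2)[symmetric] t2(2)[symmetric] by (simp only: distrib_left)
  finally show ?thesis by (simp add: add_ac)
qed

text \<open>Write V = 1 + c^2 + d^2 and x' for the wrong superposition. Up to the factor V^(n/2),
  exp (|y|^2/(2 V) - |y - x'|^2/2) is the likelihood ratio of y given x' against the law of y, so it
  has mean one for independent x'. Integrating the wrong codewords removes y altogether, before the
  law of y is used.\<close>

lemma nn_integral_wrong_codewords_exp:
  fixes c d :: real
  assumes k: "k' \<noteq> k" "k' \<noteq> l" "k' \<noteq> l'" "l' \<noteq> k" "l' \<noteq> l"
  defines "y \<equiv> \<lambda>\<omega> z t. c * \<omega> k t + d * \<omega> l t + z t"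
  shows "(\<integral>\<^sup>+\<omega>. \<integral>\<^sup>+z. ennreal (exp (K + sqn n (y \<omega> z) / (2 * (1 + c\<^sup>2 + d\<^sup>2))
           - 1 / 2 * sqn n (\<lambda>t. y \<omega> z t - c * \<omega> k' t - d * \<omega> l' t))) \<partial>gnoise n \<partial>codebook n)
     = ennreal (exp (K - real n / 2 * ln (1 + c\<^sup>2 + d\<^sup>2)))"
proof -
  interpret \<Omega>: prob_space "codebook n" by (rule prob_space_codebook)
  interpret G: prob_space "gnoise n" by (rule prob_space_gnoise)
  interpret pair_prob_space "codebook n" "gnoise n" ..
  let ?V = "1 + c\<^sup>2 + d\<^sup>2"
  let ?s1 = "(1 / 2) / (1 + 2 * (1 / 2) * (- c)\<^sup>2)"
  have p1: "0 < 1 + 2 * (1 / 2) * (- c)\<^sup>2" by (simp add: add_pos_nonneg)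
  have q1: "0 < 1 + 2 * (1 / 2) * ((- c)\<^sup>2 + (- d)\<^sup>2)" by (simp add: add_pos_nonneg)
  note t1 = gaussian_telescope[OF p1 q1]
  have Vp: "?V > 0" by (simp add: add_pos_nonneg)
  have "(\<integral>\<^sup>+\<omega>. \<integral>\<^sup>+z. ennreal (exp (K + sqn n (y \<omega> z) / (2 * ?V)
           - 1 / 2 * sqn n (\<lambda>t. y \<omega> z t - c * \<omega> k' t - d * \<omega> l' t))) \<partial>gnoise n \<partial>codebook n)
      = (\<integral>\<^sup>+z. \<integral>\<^sup>+\<omega>. ennreal (exp (K + sqn n (y \<omega> z) / (2 * ?V)
           - 1 / 2 * sqn n (\<lambda>t. y \<omega> z t - c * \<omega> k' t - d * \<omega> l' t))) \<partial>codebook n \<partial>gnoise n)"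
  \<comment> \<open>The codebook integral goes inside, so that codewords can be resampled for a
    fixed noise vector.\<close>
  proof (rule Fubini'[symmetric])
    have [measurable]: "(\<lambda>p. sqn n (y (fst p) (snd p))) \<in> borel_measurable (codebook n \<Otimes>\<^sub>M gnoise n)"
      unfolding y_def by (intro signal_measurable)
    have [measurable]: "(\<lambda>p. sqn n (\<lambda>t. y (fst p) (snd p) t - c * fst p k' t - d * fst p l' t)) \<in> borel_measurable (codebook n \<Otimes>\<^sub>M gnoise n)"
      unfolding y_def by (intro signal_measurable)
    show "(\<lambda>(\<omega>, z). ennreal (exp (K + sqn n (y \<omega> z) / (2 * ?V)
           - 1 / 2 * sqn n (\<lambda>t. y \<omega> z t - c * \<omega> k' t - d * \<omega> l' t)))) \<in> borel_measurable (codebook n \<Otimes>\<^sub>M gnoise n)"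
      unfolding case_prod_beta' by measurable
  qed
  also have "\<dots> = (\<integral>\<^sup>+z. ennreal (exp (K - real n / 2 * ln ?V)) \<partial>gnoise n)"
  proof (rule nn_integral_cong)
    fix z :: "nat \<Rightarrow> real"
    assume "z \<in> space (gnoise n)"
    have "(\<integral>\<^sup>+\<omega>. ennreal (exp (K + sqn n (y \<omega> z) / (2 * ?V)
           - 1 / 2 * sqn n (\<lambda>t. y \<omega> z t - c * \<omega> k' t - d * \<omega> l' t))) \<partial>codebook n)
      = (\<integral>\<^sup>+\<omega>. ennreal (exp (K + sqn n (y \<omega> z) / (2 * ?V) - real n / 2 * ln (1 + 2 * (1 / 2) * (- c)\<^sup>2)
           - ?s1 * sqn n (\<lambda>t. y \<omega> z t - d * \<omega> l' t))) \<partial>codebook n)"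
    proof (rule nn_integral_codebook_resample[where k=k'])
      have [measurable]: "(\<lambda>\<omega>. sqn n (y \<omega> z)) \<in> borel_measurable (codebook n)"
        unfolding y_def by (intro signal_measurable)
      have [measurable]: "(\<lambda>\<omega>. sqn n (\<lambda>t. y \<omega> z t - c * \<omega> k' t - d * \<omega> l' t)) \<in> borel_measurable (codebook n)"
        unfolding y_def by (intro signal_measurable)
      show "(\<lambda>\<omega>. ennreal (exp (K + sqn n (y \<omega> z) / (2 * ?V)
           - 1 / 2 * sqn n (\<lambda>t. y \<omega> z t - c * \<omega> k' t - d * \<omega> l' t)))) \<in> borel_measurable (codebook n)"
        by measurable
      fix \<omega> :: "nat \<times> nat \<Rightarrow> nat \<Rightarrow> real"
      have "(\<lambda>t. y (fun_upd \<omega> k' w) z t - c * (fun_upd \<omega> k' w) k' t - d * (fun_upd \<omega> k' w) l' t)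
         = (\<lambda>t. (y \<omega> z t - d * \<omega> l' t) + - c * w t)" for w
        using k by (auto simp: y_def)
      moreover have "y (fun_upd \<omega> k' w) z = y \<omega> z" for w
        using k by (auto simp: y_def)
      ultimately show "(\<integral>\<^sup>+w. ennreal (exp (K + sqn n (y (fun_upd \<omega> k' w) z) / (2 * ?V)
           - 1 / 2 * sqn n (\<lambda>t. y (fun_upd \<omega> k' w) z t - c * (fun_upd \<omega> k' w) k' t - d * (fun_upd \<omega> k' w) l' t))) \<partial>gnoise n)
         = ennreal (exp (K + sqn n (y \<omega> z) / (2 * ?V) - real n / 2 * ln (1 + 2 * (1 / 2) * (- c)\<^sup>2)
           - ?s1 * sqn n (\<lambda>t. y \<omega> z t - d * \<omega> l' t)))"
        by (simp only: nn_integral_gnoise_exp_quadratic[OF p1])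
    qed
    also have "\<dots> = (\<integral>\<^sup>+\<omega>. ennreal (exp (K - real n / 2 * ln ?V)) \<partial>codebook n)"
    proof (rule nn_integral_codebook_resample[where k=l'])
      have [measurable]: "(\<lambda>\<omega>. sqn n (y \<omega> z)) \<in> borel_measurable (codebook n)"
        unfolding y_def by (intro signal_measurable)
      have [measurable]: "(\<lambda>\<omega>. sqn n (\<lambda>t. y \<omega> z t - d * \<omega> l' t)) \<in> borel_measurable (codebook n)"
        unfolding y_def by (intro signal_measurable)
      show "(\<lambda>\<omega>. ennreal (exp (K + sqn n (y \<omega> z) / (2 * ?V) - real n / 2 * ln (1 + 2 * (1 / 2) * (- c)\<^sup>2)
           - ?s1 * sqn n (\<lambda>t. y \<omega> z t - d * \<omega> l' t)))) \<in> borel_measurable (codebook n)"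
        by measurable
      fix \<omega> :: "nat \<times> nat \<Rightarrow> nat \<Rightarrow> real"
      have "(\<lambda>t. y (fun_upd \<omega> l' w) z t - d * (fun_upd \<omega> l' w) l' t) = (\<lambda>t. y \<omega> z t + - d * w t)" for w
        using k by (auto simp: y_def)
      moreover have "y (fun_upd \<omega> l' w) z = y \<omega> z" for w
        using k by (auto simp: y_def)
      moreover have "K + sqn n (y \<omega> z) / (2 * ?V) - real n / 2 * ln (1 + 2 * (1 / 2) * (- c)\<^sup>2)
           - real n / 2 * ln (1 + 2 * ?s1 * (- d)\<^sup>2) - ?s1 / (1 + 2 * ?s1 * (- d)\<^sup>2) * sqn n (y \<omega> z)
         = K - real n / 2 * ln ?V"
      proof -
        \<comment> \<open>Starting from s = 1/2 the two integrations end at 1/(2 V), exactly the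
          coefficient of the compensating |y|^2.\<close>
        have "?s1 / (1 + 2 * ?s1 * (- d)\<^sup>2) * sqn n (y \<omega> z) = sqn n (y \<omega> z) / (2 * ?V)"
          unfolding t1(3) by (simp add: add_ac)
        moreover have "real n / 2 * ln (1 + 2 * (1 / 2) * (- c)\<^sup>2) + real n / 2 * ln (1 + 2 * ?s1 * (- d)\<^sup>2) = real n / 2 * ln ?V"
          unfolding distrib_left[symmetric] t1(2) by (simp add: add_ac)
        ultimately show ?thesis by linarith
      qed
      ultimately show "(\<integral>\<^sup>+w. ennreal (exp (K + sqn n (y (fun_upd \<omega> l' w) z) / (2 * ?V) - real n / 2 * ln (1 + 2 * (1 / 2) * (- c)\<^sup>2)
           - ?s1 * sqn n (\<lambda>t. y (fun_upd \<omega> l' w) z t - d * (fun_upd \<omega> l' w) l' t))) \<partial>gnoise n)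
          = ennreal (exp (K - real n / 2 * ln ?V))"
        by (simp only: nn_integral_gnoise_exp_quadratic[OF t1(1)])
    qed
    also have "\<dots> = ennreal (exp (K - real n / 2 * ln ?V))"
      by (simp add: \<Omega>.emeasure_space_1)
    finally show "(\<integral>\<^sup>+\<omega>. ennreal (exp (K + sqn n (y \<omega> z) / (2 * ?V)
           - 1 / 2 * sqn n (\<lambda>t. y \<omega> z t - c * \<omega> k' t - d * \<omega> l' t))) \<partial>codebook n) = ennreal (exp (K - real n / 2 * ln ?V))" .
  qed
  also have "\<dots> = ennreal (exp (K - real n / 2 * ln ?V))"
    by (simp add: G.emeasure_space_1)
  finally show ?thesis .
qed

section \<open>Encoder, decoder and the decomposition of the error event\<close>

lemma sqn_cong: "(\<And>t. t < n \<Longrightarrow> x t = y t) \<Longrightarrow> sqn n x = sqn n y"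
  by (simp add: sqn_def)

text \<open>A codeword that violates the power constraint is replaced by zero at the encoder; the decoder keeps using
  the original codebook, so only the probability of a violation is lost.\<close>
definition truncate_power :: "nat \<Rightarrow> real \<Rightarrow> (nat \<Rightarrow> real) \<Rightarrow> nat \<Rightarrow> real" where
  "truncate_power n P x = (if sqn n x \<le> real n * P then x else (\<lambda>_. 0))"

lemma power_ok_truncate: "0 \<le> P \<Longrightarrow> power_ok n P M (\<lambda>m. truncate_power n P (x m))"
  by (auto simp: power_ok_def truncate_power_def sqn_def)

text \<open>The interfering index is only asked to exist, never to be unique. \<open>LEAST\<close>
  breaks ties; it is arbitrary when no j qualifies, which for a transmitted pair requires noise of
  squared norm above n T.\<close>

definition dist_decoder ::
  "nat \<Rightarrow> real \<Rightarrow> nat \<Rightarrow> nat \<Rightarrow> (nat \<Rightarrow> nat \<Rightarrow> real) \<Rightarrow> (nat \<Rightarrow> nat \<Rightarrow> real) \<Rightarrow> (nat \<Rightarrow> real) \<Rightarrow> nat" where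
  "dist_decoder n T MA MB xA xB y =
     (LEAST j. j < MB \<and> (\<exists>i\<in>{..<MA}. sqn n (\<lambda>t. y t - xB j t - xA i t) \<le> real n * T))"

lemma dist_decoder_ok: "decoder_ok n (dist_decoder n T MA MB xA xB)"
proof -
  have "dist_decoder n T MA MB xA xB \<in> measurable (PiM {..<n} (\<lambda>_. borel)) (count_space UNIV)"
    unfolding dist_decoder_def[abs_def] by measurable
  then show ?thesis
    unfolding decoder_ok_def using measurable_cong_sets[OF sets_PiM_lborel refl] by blast
qed

text \<open>If noise, \<open>u\<close> and \<open>y\<close> are typical, the true pair passes the
  test and a wrong j' must pass it too. With i' = i the interference cancels and \<open>u\<close> is
  the relevant output, otherwise it is \<open>y\<close>. Pairs with j' = j and i' \<noteq> i cause
  no error, so the rate of the interferer is never constrained on its own.\<close>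

lemma dist_decoder_error_bound:
  fixes u y z :: "nat \<Rightarrow> real"
  assumes ij: "i < MA" "j < MB"
    and s: "s0 < 0" "s1 > 0" "s2 > 0" and V: "V1 > 0" "V2 > 0"
    and u: "\<And>t. t < n \<Longrightarrow> u t = xB j t + z t" and y: "\<And>t. t < n \<Longrightarrow> y t = xB j t + xA i t + z t"
    and err: "dist_decoder n T MA MB xA xB y \<noteq> j"
  shows "1 \<le> exp (s0 * (real n * T) - s0 * sqn n z) + exp (s1 * (real n * T1) - s1 * sqn n u)
      + exp (s2 * (real n * T2) - s2 * sqn n y)
      + (\<Sum>j'\<in>{..<MB} - {j}. exp (real n * T / 2 - real n * T1 / (2 * V1) + sqn n u / (2 * V1) - 1 / 2 * sqn n (\<lambda>t. u t - xB j' t)))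
      + (\<Sum>j'\<in>{..<MB} - {j}. \<Sum>i'\<in>{..<MA} - {i}.
          exp (real n * T / 2 - real n * T2 / (2 * V2) + sqn n y / (2 * V2) - 1 / 2 * sqn n (\<lambda>t. y t - xB j' t - xA i' t)))"
    (is "1 \<le> ?a + ?b + ?c + (\<Sum>j'\<in>?J. ?d j') + (\<Sum>j'\<in>?J. \<Sum>i'\<in>?I. ?e j' i')")
proof -
  have d0: "0 \<le> (\<Sum>j'\<in>?J. ?d j')" by (intro sum_nonneg) auto
  have e0: "0 \<le> (\<Sum>j'\<in>?J. \<Sum>i'\<in>?I. ?e j' i')" by (intro sum_nonneg) auto
  have pos: "0 < ?a" "0 < ?b" "0 < ?c" by auto
  consider "sqn n z > real n * T" | "sqn n u < real n * T1" | "sqn n y < real n * T2"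
    | "sqn n z \<le> real n * T" "sqn n u \<ge> real n * T1" "sqn n y \<ge> real n * T2" by linarith
  then show ?thesis
  proof cases
    case 1
    then have "s0 * sqn n z \<le> s0 * (real n * T)" using s by (intro mult_left_mono_neg) auto
    then have "1 \<le> ?a" by simp
    then show ?thesis using pos d0 e0 by linarith
  next
    case 2
    then have "s1 * sqn n u \<le> s1 * (real n * T1)" using s by (intro mult_left_mono) auto
    then have "1 \<le> ?b" by simp
    then show ?thesis using pos d0 e0 by linarith
  next
    case 3
    then have "s2 * sqn n y \<le> s2 * (real n * T2)" using s by (intro mult_left_mono) auto
    then have "1 \<le> ?c" by simp
    then show ?thesis using pos d0 e0 by linarith
  next
    case 4
    let ?P = "\<lambda>j. j < MB \<and> (\<exists>i\<in>{..<MA}. sqn n (\<lambda>t. y t - xB j t - xA i t) \<le> real n * T)"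
    have "sqn n (\<lambda>t. y t - xB j t - xA i t) = sqn n z" by (intro sqn_cong) (simp add: y)
    then have Pj: "?P j" using ij 4 by (auto intro!: bexI[of _ i])
    define j' where "j' = (LEAST j. ?P j)"
    have "?P j'" unfolding j'_def by (rule LeastI[of ?P, OF Pj])
    then obtain i' where j': "j' < MB" and i': "i' < MA"
      and cl: "sqn n (\<lambda>t. y t - xB j' t - xA i' t) \<le> real n * T" by auto
    have "j' \<noteq> j" using err unfolding j'_def dist_decoder_def by simp
    then have J: "j' \<in> ?J" using j' by simp
    show ?thesis
    proof (cases "i' = i")
      case True
      have "sqn n (\<lambda>t. y t - xB j' t - xA i' t) = sqn n (\<lambda>t. u t - xB j' t)"
        by (intro sqn_cong) (simp add: y u True)
      \<comment> \<open>Typicality from below: adding (|u|^2 - n T1)/(2 V1) does not lower the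
        exponent and brings it into likelihood-ratio form.\<close>
      moreover have "real n * T1 / (2 * V1) \<le> sqn n u / (2 * V1)"
        using 4 V by (intro divide_right_mono) auto
      ultimately have "1 \<le> ?d j'" using cl by simp
      also have "\<dots> \<le> (\<Sum>j'\<in>?J. ?d j')" by (rule member_le_sum[OF J]) auto
      finally show ?thesis using pos e0 by linarith
    next
      case False
      then have I: "i' \<in> ?I" using i' by simp
      have "real n * T2 / (2 * V2) \<le> sqn n y / (2 * V2)"
        using 4 V by (intro divide_right_mono) auto
      then have "1 \<le> ?e j' i'" using cl by simp
      also have "\<dots> \<le> (\<Sum>i'\<in>?I. ?e j' i')" by (rule member_le_sum[OF I]) auto
      also have "\<dots> \<le> (\<Sum>j'\<in>?J. \<Sum>i'\<in>?I. ?e j' i')" by (rule member_le_sum[OF J]) (auto intro!: sum_nonneg)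
      finally show ?thesis using pos d0 by linarith
    qed
  qed
qed

section \<open>Expected error of one receiver\<close>

text \<open>A Chernoff bound given the codebook \<omega>. With c = d = 0 it concerns the noise
  alone, with d = 0 the output freed from interference.\<close>

definition atypical_bound where
  "atypical_bound n K s c d k l \<omega> =
     (\<integral>\<^sup>+z. ennreal (exp (K - s * sqn n (\<lambda>t. c * \<omega> k t + d * \<omega> l t + z t))) \<partial>gnoise n)"

text \<open>The likelihood-ratio estimate of one wrong pair (k', l') against the true (k, l), given
  the codebook. For d = 0 the interferer is taken as known and only k' is wrong.\<close>

definition confusion_bound where
  "confusion_bound n K c d k l k' l' \<omega> =
     (\<integral>\<^sup>+z. ennreal (exp (K + sqn n (\<lambda>t. c * \<omega> k t + d * \<omega> l t + z t) / (2 * (1 + c\<^sup>2 + d\<^sup>2))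
        - 1 / 2 * sqn n (\<lambda>t. c * \<omega> k t + d * \<omega> l t + z t - c * \<omega> k' t - d * \<omega> l' t))) \<partial>gnoise n)"

lemma atypical_bound_measurable [measurable]:
  "atypical_bound n K s c d k l \<in> borel_measurable (codebook n)"
proof -
  interpret G: prob_space "gnoise n" by (rule prob_space_gnoise)
  have [measurable]: "(\<lambda>p. sqn n (\<lambda>t. c * fst p k t + d * fst p l t + snd p t)) \<in> borel_measurable (codebook n \<Otimes>\<^sub>M gnoise n)"
    by (intro signal_measurable)
  have "(\<lambda>(\<omega>, z). ennreal (exp (K - s * sqn n (\<lambda>t. c * \<omega> k t + d * \<omega> l t + z t)))) \<in> borel_measurable (codebook n \<Otimes>\<^sub>M gnoise n)"
    unfolding case_prod_beta' by measurable
  then show ?thesis unfolding atypical_bound_def[abs_def] by (rule G.borel_measurable_nn_integral)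
qed

lemma confusion_bound_measurable [measurable]:
  "confusion_bound n K c d k l k' l' \<in> borel_measurable (codebook n)"
proof -
  interpret G: prob_space "gnoise n" by (rule prob_space_gnoise)
  have [measurable]: "(\<lambda>p. sqn n (\<lambda>t. c * fst p k t + d * fst p l t + snd p t)) \<in> borel_measurable (codebook n \<Otimes>\<^sub>M gnoise n)"
    by (intro signal_measurable)
  have [measurable]: "(\<lambda>p. sqn n (\<lambda>t. c * fst p k t + d * fst p l t + snd p t - c * fst p k' t - d * fst p l' t))
      \<in> borel_measurable (codebook n \<Otimes>\<^sub>M gnoise n)"
    by (intro signal_measurable)
  have "(\<lambda>(\<omega>, z). ennreal (exp (K + sqn n (\<lambda>t. c * \<omega> k t + d * \<omega> l t + z t) / (2 * (1 + c\<^sup>2 + d\<^sup>2))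
        - 1 / 2 * sqn n (\<lambda>t. c * \<omega> k t + d * \<omega> l t + z t - c * \<omega> k' t - d * \<omega> l' t)))) \<in> borel_measurable (codebook n \<Otimes>\<^sub>M gnoise n)"
    unfolding case_prod_beta' by measurable
  then show ?thesis unfolding confusion_bound_def[abs_def] by (rule G.borel_measurable_nn_integral)
qed

lemma err_prob_le_1: "err_prob n x dec m \<le> 1"
  unfolding err_prob_def by (rule prob_space.prob_le_1[OF prob_space_gnoise])

text \<open>The index (iA, Suc i) is a dummy: it carries the coefficient 0 and only has to differ from (iA, i).\<close>
definition receiver_bound where
  "receiver_bound n \<delta> a cA cB PA PB s0 s1 s2 sA sB iA iB MA MB i j \<omega> =
     atypical_bound n (s0 * (real n * (1 + \<delta>))) s0 0 0 (iB, j) (iA, i) \<omega>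
   + atypical_bound n (s1 * (real n * ((1 + cB\<^sup>2) * (1 - \<delta>)))) s1 cB 0 (iB, j) (iA, i) \<omega>
   + atypical_bound n (s2 * (real n * ((1 + cB\<^sup>2 + (a * cA)\<^sup>2) * (1 - \<delta>)))) s2 cB (a * cA) (iB, j) (iA, i) \<omega>
   + (\<Sum>j'\<in>{..<MB} - {j}. confusion_bound n (real n * \<delta>) cB 0 (iB, j) (iA, i) (iB, j') (iA, Suc i) \<omega>)
   + (\<Sum>j'\<in>{..<MB} - {j}. \<Sum>i'\<in>{..<MA} - {i}.
        confusion_bound n (real n * \<delta>) cB (a * cA) (iB, j) (iA, i) (iB, j') (iA, i') \<omega>)
   + ennreal (exp (sA * (real n * PA) - sA * sqn n (\<lambda>t. cA * \<omega> (iA, i) t)))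
   + ennreal (exp (sB * (real n * PB) - sB * sqn n (\<lambda>t. cB * \<omega> (iB, j) t)))"

lemma codeword_exp_measurable [measurable]:
  "(\<lambda>\<omega>. ennreal (exp (K - s * sqn n (\<lambda>t. c * \<omega> k t)))) \<in> borel_measurable (codebook n)"
proof -
  have [measurable]: "(\<lambda>\<omega>. sqn n (\<lambda>t. c * \<omega> k t)) \<in> borel_measurable (codebook n)"
    by (intro signal_measurable)
  show ?thesis by measurable
qed

lemma receiver_bound_measurable [measurable]:
  "receiver_bound n \<delta> a cA cB PA PB s0 s1 s2 sA sB iA iB MA MB i j \<in> borel_measurable (codebook n)"
  unfolding receiver_bound_def[abs_def]
  by (intro borel_measurable_add borel_measurable_sum atypical_bound_measurable confusion_bound_measurable codeword_exp_measurable)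

lemma nn_integral_add7:
  assumes "f1 \<in> borel_measurable M" "f2 \<in> borel_measurable M" "f3 \<in> borel_measurable M" "f4 \<in> borel_measurable M"
    "f5 \<in> borel_measurable M" "f6 \<in> borel_measurable M" "f7 \<in> borel_measurable M"
  shows "(\<integral>\<^sup>+x. f1 x + f2 x + f3 x + f4 x + f5 x + f6 x + f7 x \<partial>M) =
    (\<integral>\<^sup>+x. f1 x \<partial>M) + (\<integral>\<^sup>+x. f2 x \<partial>M) + (\<integral>\<^sup>+x. f3 x \<partial>M) + (\<integral>\<^sup>+x. f4 x \<partial>M)
    + (\<integral>\<^sup>+x. f5 x \<partial>M) + (\<integral>\<^sup>+x. f6 x \<partial>M) + (\<integral>\<^sup>+x. f7 x \<partial>M)"
  using assms by (simp add: nn_integral_add)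

lemma nn_integral_receiver_bound_le:
  assumes iAB: "iA \<noteq> iB"
    and p: "0 < 1 + 2 * s0 * 1" "0 < 1 + 2 * s1 * (1 + cB\<^sup>2)" "0 < 1 + 2 * s2 * (1 + cB\<^sup>2 + (a * cA)\<^sup>2)"
      "0 < 1 + 2 * sA * cA\<^sup>2" "0 < 1 + 2 * sB * cB\<^sup>2"
  shows "(\<integral>\<^sup>+\<omega>. receiver_bound n \<delta> a cA cB PA PB s0 s1 s2 sA sB iA iB MA MB i j \<omega> \<partial>codebook n)
    \<le> ennreal (exp (real n * (s0 * (1 + \<delta>) - ln (1 + 2 * s0 * 1) / 2))
     + exp (real n * (s1 * ((1 + cB\<^sup>2) * (1 - \<delta>)) - ln (1 + 2 * s1 * (1 + cB\<^sup>2)) / 2))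
     + exp (real n * (s2 * ((1 + cB\<^sup>2 + (a * cA)\<^sup>2) * (1 - \<delta>)) - ln (1 + 2 * s2 * (1 + cB\<^sup>2 + (a * cA)\<^sup>2)) / 2))
     + real MB * exp (real n * (\<delta> - ln (1 + cB\<^sup>2) / 2))
     + real MB * real MA * exp (real n * (\<delta> - ln (1 + cB\<^sup>2 + (a * cA)\<^sup>2) / 2))
     + exp (real n * (sA * PA - ln (1 + 2 * sA * cA\<^sup>2) / 2))
     + exp (real n * (sB * PB - ln (1 + 2 * sB * cB\<^sup>2) / 2)))"
    (is "_ \<le> ennreal (?e0 + ?e1 + ?e2 + real MB * ?e3 + real MB * real MA * ?e4 + ?eA + ?eB)")
proof -
  let ?k = "(iB, j)" and ?l = "(iA, i)"
  have kl: "?k \<noteq> ?l" using iAB by simp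
  have A: "(\<integral>\<^sup>+\<omega>. atypical_bound n (s * (real n * T)) s c d ?k ?l \<omega> \<partial>codebook n)
      = ennreal (exp (real n * (s * T - ln (1 + 2 * s * (1 + c\<^sup>2 + d\<^sup>2)) / 2)))"
    if "0 < 1 + 2 * s * (1 + c\<^sup>2 + d\<^sup>2)" for s T c d
    unfolding atypical_bound_def nn_integral_received_exp[OF that kl] by (simp add: algebra_simps)
  have B: "(\<integral>\<^sup>+\<omega>. confusion_bound n (real n * \<delta>) c d ?k ?l (iB, j') (iA, i') \<omega> \<partial>codebook n)
      = ennreal (exp (real n * (\<delta> - ln (1 + c\<^sup>2 + d\<^sup>2) / 2)))"
    if "j' \<noteq> j" "i' \<noteq> i" for c d j' i'
    unfolding confusion_bound_def using that iAB
    by (subst nn_integral_wrong_codewords_exp) (auto simp: algebra_simps)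
  have C: "(\<integral>\<^sup>+\<omega>. ennreal (exp (s * (real n * P) - s * sqn n (\<lambda>t. c * \<omega> k t))) \<partial>codebook n)
     = ennreal (exp (real n * (s * P - ln (1 + 2 * s * c\<^sup>2) / 2)))"
    if "0 < 1 + 2 * s * c\<^sup>2" for s P c k
    unfolding nn_integral_codeword_exp[OF that] by (simp add: algebra_simps)
  have "(\<integral>\<^sup>+\<omega>. receiver_bound n \<delta> a cA cB PA PB s0 s1 s2 sA sB iA iB MA MB i j \<omega> \<partial>codebook n)
     = ennreal ?e0 + ennreal ?e1 + ennreal ?e2 + (\<Sum>j'\<in>{..<MB} - {j}. ennreal ?e3)
       + (\<Sum>j'\<in>{..<MB} - {j}. \<Sum>i'\<in>{..<MA} - {i}. ennreal ?e4) + ennreal ?eA + ennreal ?eB"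
  proof -
    have "(\<integral>\<^sup>+\<omega>. (\<Sum>j'\<in>{..<MB} - {j}. confusion_bound n (real n * \<delta>) cB 0 ?k ?l (iB, j') (iA, Suc i) \<omega>) \<partial>codebook n)
      = (\<Sum>j'\<in>{..<MB} - {j}. ennreal ?e3)"
      using B[of _ "Suc i" cB 0] by (subst nn_integral_sum) (auto intro!: sum.cong)
    moreover have "(\<integral>\<^sup>+\<omega>. (\<Sum>j'\<in>{..<MB} - {j}. \<Sum>i'\<in>{..<MA} - {i}.
        confusion_bound n (real n * \<delta>) cB (a * cA) ?k ?l (iB, j') (iA, i') \<omega>) \<partial>codebook n)
      = (\<Sum>j'\<in>{..<MB} - {j}. \<Sum>i'\<in>{..<MA} - {i}. ennreal ?e4)"
      using B[of _ _ cB "a * cA"] by (subst nn_integral_sum, simp, intro sum.cong refl, subst nn_integral_sum) (auto intro!: sum.cong)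
    moreover note A[of s0 0 0 "1 + \<delta>"] A[of s1 cB 0 "(1 + cB\<^sup>2) * (1 - \<delta>)"]
      A[of s2 cB "a * cA" "(1 + cB\<^sup>2 + (a * cA)\<^sup>2) * (1 - \<delta>)"] C[OF p(4), of PA ?l] C[OF p(5), of PB ?k]
    ultimately show ?thesis
      unfolding receiver_bound_def using p
      by (subst nn_integral_add7) (simp_all only: atypical_bound_measurable confusion_bound_measurable
          codeword_exp_measurable borel_measurable_sum zero_power2 add_0_right)
  qed
  \<comment> \<open>Readmitting the true indices to the sums enlarges them only slightly and gives
    plain factors \<open>MB\<close> and \<open>MA\<close>.\<close>
  also have "\<dots> \<le> ennreal ?e0 + ennreal ?e1 + ennreal ?e2 + (\<Sum>j'\<in>{..<MB}. ennreal ?e3)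
       + (\<Sum>j'\<in>{..<MB}. \<Sum>i'\<in>{..<MA}. ennreal ?e4) + ennreal ?eA + ennreal ?eB"
    by (intro add_mono order_refl sum_mono2 order_trans[OF sum_mono sum_mono2]) auto
  also have "\<dots> = ennreal (?e0 + ?e1 + ?e2 + real MB * ?e3 + real MB * real MA * ?e4 + ?eA + ?eB)"
    by (simp add: ennreal_plus ennreal_mult ennreal_of_nat_eq_real_of_nat mult.assoc)
  finally show ?thesis .
qed

text \<open>If a transmitted codeword breaks its power limit, one of the last two terms of the bound
  is already at least one. Otherwise truncation changes nothing, and the sent codewords agree with
  those in the decoder's book.\<close>

lemma err_prob_le_receiver_bound:
  assumes ij: "i < MA" "j < MB" and s: "s0 < 0" "s1 > 0" "s2 > 0" "sA < 0" "sB < 0"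
  shows "ennreal (err_prob n (\<lambda>t. truncate_power n PB (\<lambda>t. cB * \<omega> (iB, j) t) t
              + a * truncate_power n PA (\<lambda>t. cA * \<omega> (iA, i) t) t)
        (dist_decoder n (1 + \<delta>) MA MB (\<lambda>i t. a * cA * \<omega> (iA, i) t) (\<lambda>j t. cB * \<omega> (iB, j) t)) j)
     \<le> receiver_bound n \<delta> a cA cB PA PB s0 s1 s2 sA sB iA iB MA MB i j \<omega>" (is "ennreal (err_prob n ?x ?dec j) \<le> ?R")
proof -
  interpret G: prob_space "gnoise n" by (rule prob_space_gnoise)
  let ?wA = "\<lambda>t. cA * \<omega> (iA, i) t" and ?wB = "\<lambda>t. cB * \<omega> (iB, j) t"
  have e1: "ennreal (err_prob n ?x ?dec j) \<le> 1"
    using err_prob_le_1 by (simp add: ennreal_le_1)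
  consider "sqn n ?wA > real n * PA" | "sqn n ?wB > real n * PB" | "sqn n ?wA \<le> real n * PA" "sqn n ?wB \<le> real n * PB"
    by linarith
  then show ?thesis
  proof cases
    case 1
    then have "s * sqn n ?wA \<le> s * (real n * PA)" if "s < 0" for s using that by (intro mult_left_mono_neg) auto
    then have "(1::ennreal) \<le> ennreal (exp (sA * (real n * PA) - sA * sqn n ?wA))"
      using s by simp
    also have "\<dots> \<le> ?R" unfolding receiver_bound_def by (simp add: add_increasing add_increasing2)
    finally show ?thesis using e1 by (rule order_trans[rotated])
  next
    case 2
    then have "s * sqn n ?wB \<le> s * (real n * PB)" if "s < 0" for s using that by (intro mult_left_mono_neg) auto
    then have "(1::ennreal) \<le> ennreal (exp (sB * (real n * PB) - sB * sqn n ?wB))"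
      using s by simp
    also have "\<dots> \<le> ?R" unfolding receiver_bound_def by (simp add: add_increasing add_increasing2)
    finally show ?thesis using e1 by (rule order_trans[rotated])
  next
    case 3
    let ?V1 = "1 + cB\<^sup>2" and ?V2 = "1 + cB\<^sup>2 + (a * cA)\<^sup>2"
    have V: "?V1 > 0" "?V2 > 0" by (simp_all add: add_pos_nonneg)
    let ?u = "\<lambda>z t. cB * \<omega> (iB, j) t + z t" and ?y = "\<lambda>z t. cB * \<omega> (iB, j) t + a * cA * \<omega> (iA, i) t + z t"
    let ?a = "\<lambda>z. exp (s0 * (real n * (1 + \<delta>)) - s0 * sqn n z)"
      and ?b = "\<lambda>z. exp (s1 * (real n * (?V1 * (1 - \<delta>))) - s1 * sqn n (?u z))"
      and ?c = "\<lambda>z. exp (s2 * (real n * (?V2 * (1 - \<delta>))) - s2 * sqn n (?y z))"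
      and ?d = "\<lambda>j' z. exp (real n * \<delta> + sqn n (?u z) / (2 * ?V1) - 1 / 2 * sqn n (\<lambda>t. ?u z t - cB * \<omega> (iB, j') t))"
      and ?e = "\<lambda>j' i' z. exp (real n * \<delta> + sqn n (?y z) / (2 * ?V2)
            - 1 / 2 * sqn n (\<lambda>t. ?y z t - cB * \<omega> (iB, j') t - a * cA * \<omega> (iA, i') t))"
    let ?J = "{..<MB} - {j}" and ?I = "{..<MA} - {i}"
    note [measurable] = decoder_measurable[OF dist_decoder_ok]
    let ?D = "{z \<in> space (gnoise n). ?dec (\<lambda>t\<in>{..<n}. ?x t + z t) \<noteq> j}"
    have Dm[measurable]: "?D \<in> sets (gnoise n)" by measurable
    have x: "?x t = cB * \<omega> (iB, j) t + a * cA * \<omega> (iA, i) t" for t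
      using 3 by (simp add: truncate_power_def)
    have pt: "indicator ?D z \<le> ennreal (?a z) + ennreal (?b z) + ennreal (?c z)
        + (\<Sum>j'\<in>?J. ennreal (?d j' z)) + (\<Sum>j'\<in>?J. \<Sum>i'\<in>?I. ennreal (?e j' i' z))" for z
    proof (cases "z \<in> ?D")
      case True
      let ?yr = "\<lambda>t\<in>{..<n}. ?x t + z t"
      have sq: "sqn n ?yr = sqn n (?y z)"
        "sqn n (\<lambda>t. ?yr t - cB * \<omega> (iB, j') t - a * cA * \<omega> (iA, i') t)
          = sqn n (\<lambda>t. ?y z t - cB * \<omega> (iB, j') t - a * cA * \<omega> (iA, i') t)" for j' i'
        by (auto intro!: sqn_cong simp: x)
      \<comment> \<open>The thresholds n (1 + \<delta>) from above and n V (1 - \<delta>) from below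
        leave the same loss n \<delta> for every V.\<close>
      have c1: "real n * (1 + \<delta>) / 2 - real n * (V * (1 - \<delta>)) / (2 * V) = real n * \<delta>" if "V > 0" for V
        using that by (simp add: field_simps)
      have "1 \<le> ?a z + ?b z + ?c z + (\<Sum>j'\<in>?J. ?d j' z) + (\<Sum>j'\<in>?J. \<Sum>i'\<in>?I. ?e j' i' z)"
        using dist_decoder_error_bound[OF ij s(1-3) V, of n "?u z" "\<lambda>j t. cB * \<omega> (iB, j) t" z ?yr
            "\<lambda>i t. a * cA * \<omega> (iA, i) t" "1 + \<delta>" "?V1 * (1 - \<delta>)" "?V2 * (1 - \<delta>)"] True
        unfolding sq c1[OF V(1)] c1[OF V(2)] by (simp add: x)
      then have "ennreal 1 \<le> ennreal (?a z + ?b z + ?c z + (\<Sum>j'\<in>?J. ?d j' z) + (\<Sum>j'\<in>?J. \<Sum>i'\<in>?I. ?e j' i' z))"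
        by (rule ennreal_leI)
      then show ?thesis using True
        by (simp add: sum_nonneg)
    qed simp
    have "ennreal (err_prob n ?x ?dec j) = (\<integral>\<^sup>+z. indicator ?D z \<partial>gnoise n)"
      unfolding err_prob_def by (simp add: G.emeasure_eq_measure)
    also have "\<dots> \<le> (\<integral>\<^sup>+z. ennreal (?a z) + ennreal (?b z) + ennreal (?c z)
        + (\<Sum>j'\<in>?J. ennreal (?d j' z)) + (\<Sum>j'\<in>?J. \<Sum>i'\<in>?I. ennreal (?e j' i' z)) \<partial>gnoise n)"
      by (intro nn_integral_mono pt)
    also have "\<dots> = (\<integral>\<^sup>+z. ennreal (?a z) \<partial>gnoise n) + (\<integral>\<^sup>+z. ennreal (?b z) \<partial>gnoise n) + (\<integral>\<^sup>+z. ennreal (?c z) \<partial>gnoise n)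
        + (\<Sum>j'\<in>?J. \<integral>\<^sup>+z. ennreal (?d j' z) \<partial>gnoise n) + (\<Sum>j'\<in>?J. \<Sum>i'\<in>?I. \<integral>\<^sup>+z. ennreal (?e j' i' z) \<partial>gnoise n)"
      by (simp add: nn_integral_add nn_integral_sum del: sum_ennreal)
    also have "\<dots> \<le> ?R"
      unfolding receiver_bound_def atypical_bound_def confusion_bound_def
      by (simp add: add_increasing2)
    finally show ?thesis .
  qed
qed

lemma exp_linear_null:
  assumes "g < 0"
  shows "(\<lambda>n. exp (real n * g)) \<longlonglongrightarrow> 0"
proof -
  have "(\<lambda>n. exp g ^ n) \<longlonglongrightarrow> 0" using assms by (intro LIMSEQ_power_zero) auto
  then show ?thesis by (simp add: exp_of_nat_mult)
qed

lemma Cg_mult_ln2: "Cg x * ln 2 = ln (1 + x) / 2"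
  by (simp add: Cg_def log_def)

text \<open>\<open>E\<close> is a measurable majorant of the error as a function of the codebook,
  with a mean bounded uniformly in the messages; later averages use \<open>E\<close> only.
  Amplitudes strictly inside the power limits make violations exponentially rare, and the factor 2
  in the code sizes allows for rounding.\<close>

lemma random_coding_receiver:
  fixes a cA cB :: real
  assumes i: "iA \<noteq> iB" and c: "0 < cA" "0 < cB" "cA\<^sup>2 < PA" "cB\<^sup>2 < PB"
    and R: "RB < Cg (cB\<^sup>2)" "RA + RB < Cg ((a * cA)\<^sup>2 + cB\<^sup>2)"
    and M: "\<And>n. real (MA n) \<le> 2 * 2 powr (real n * RA)" "\<And>n. real (MB n) \<le> 2 * 2 powr (real n * RB)"
  obtains E :: "nat \<Rightarrow> nat \<Rightarrow> nat \<Rightarrow> (nat \<times> nat \<Rightarrow> nat \<Rightarrow> real) \<Rightarrow> ennreal" and \<epsilon> :: "nat \<Rightarrow> real"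
    and dec :: "nat \<Rightarrow> (nat \<times> nat \<Rightarrow> nat \<Rightarrow> real) \<Rightarrow> (nat \<Rightarrow> real) \<Rightarrow> nat"
  where "\<epsilon> \<longlonglongrightarrow> 0" "\<And>n. 0 \<le> \<epsilon> n"
    "\<And>n i j. E n i j \<in> borel_measurable (codebook n)"
    "\<And>n i j. (\<integral>\<^sup>+\<omega>. E n i j \<omega> \<partial>codebook n) \<le> ennreal (\<epsilon> n)"
    "\<And>n \<omega>. decoder_ok n (dec n \<omega>)"
    "\<And>n \<omega> i j. i < MA n \<Longrightarrow> j < MB n \<Longrightarrow>
       ennreal (err_prob n (\<lambda>t. truncate_power n PB (\<lambda>t. cB * \<omega> (iB, j) t) t
              + a * truncate_power n PA (\<lambda>t. cA * \<omega> (iA, i) t) t) (dec n \<omega>) j) \<le> E n i j \<omega>"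
proof -
  let ?V1 = "1 + cB\<^sup>2" and ?V2 = "1 + cB\<^sup>2 + (a * cA)\<^sup>2"
  have V: "?V1 > 0" "?V2 > 0" by (simp_all add: add_pos_nonneg)
  have r1: "RB * ln 2 < ln ?V1 / 2" 
    using mult_strict_right_mono[OF R(1), of "ln 2"] by (simp add: Cg_mult_ln2)
  have r2: "(RA + RB) * ln 2 < ln ?V2 / 2"
    using mult_strict_right_mono[OF R(2), of "ln 2"] by (simp add: Cg_mult_ln2 add_ac)
  \<comment> \<open>Half of each rate gap, so the confusion exponents remain negative after the loss
    \<delta>. The cap 1/2 keeps the lower thresholds V (1 - \<delta>) positive.\<close>
  define \<delta> where "\<delta> = min (1 / 2) (min ((ln ?V1 / 2 - RB * ln 2) / 2) ((ln ?V2 / 2 - (RA + RB) * ln 2) / 2))"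
  have d: "0 < \<delta>" "\<delta> < 1" using r1 r2 by (auto simp: \<delta>_def)
  have g3: "RB * ln 2 + (\<delta> - ln ?V1 / 2) < 0" and g4: "(RA + RB) * ln 2 + (\<delta> - ln ?V2 / 2) < 0"
  proof -
    have "\<delta> \<le> (ln ?V1 / 2 - RB * ln 2) / 2" "\<delta> \<le> (ln ?V2 / 2 - (RA + RB) * ln 2) / 2"
      unfolding \<delta>_def by linarith+
    with r1 r2 show "RB * ln 2 + (\<delta> - ln ?V1 / 2) < 0" and "(RA + RB) * ln 2 + (\<delta> - ln ?V2 / 2) < 0"
      by argo+
  qed
  obtain s0 where s0: "(1 - (1 + \<delta>)) * s0 > 0" "1 + 2 * s0 * 1 > 0" "s0 * (1 + \<delta>) < ln (1 + 2 * s0 * 1) / 2"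
    using chernoff_rate[of 1 "1 + \<delta>"] d by auto
  have low: "V * (1 - \<delta>) > 0" "V * (1 - \<delta>) \<noteq> V" "V - V * (1 - \<delta>) > 0" if "V > 0" for V
    using that d by (auto simp: algebra_simps)
  obtain s1 where s1: "(?V1 - ?V1 * (1 - \<delta>)) * s1 > 0" "1 + 2 * s1 * ?V1 > 0" "s1 * (?V1 * (1 - \<delta>)) < ln (1 + 2 * s1 * ?V1) / 2"
    using chernoff_rate[OF V(1) low(1,2)[OF V(1)]] by auto
  obtain s2 where s2: "(?V2 - ?V2 * (1 - \<delta>)) * s2 > 0" "1 + 2 * s2 * ?V2 > 0" "s2 * (?V2 * (1 - \<delta>)) < ln (1 + 2 * s2 * ?V2) / 2"
    using chernoff_rate[OF V(2) low(1,2)[OF V(2)]] by auto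
  have cc: "0 < cA\<^sup>2" "0 < cB\<^sup>2" "0 < PA" "0 < PB" using c by (auto intro: less_trans[of 0 "cA\<^sup>2"] less_trans[of 0 "cB\<^sup>2"])
  obtain sA where sA: "(cA\<^sup>2 - PA) * sA > 0" "1 + 2 * sA * cA\<^sup>2 > 0" "sA * PA < ln (1 + 2 * sA * cA\<^sup>2) / 2"
    using chernoff_rate[of "cA\<^sup>2" PA] cc c by auto
  obtain sB where sB: "(cB\<^sup>2 - PB) * sB > 0" "1 + 2 * sB * cB\<^sup>2 > 0" "sB * PB < ln (1 + 2 * sB * cB\<^sup>2) / 2"
    using chernoff_rate[of "cB\<^sup>2" PB] cc c by auto
  \<comment> \<open>Excess noise and excess power are upper tails, hence negative parameters; short
    \<open>u\<close> and \<open>y\<close> are lower tails.\<close>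
  have s: "s0 < 0" "s1 > 0" "s2 > 0" "sA < 0" "sB < 0"
    using s0(1) s1(1) s2(1) sA(1) sB(1) d low(3)[OF V(1)] low(3)[OF V(2)] c
    by (auto simp: zero_less_mult_iff mult_less_0_iff)
  let ?e0 = "\<lambda>n. exp (real n * (s0 * (1 + \<delta>) - ln (1 + 2 * s0 * 1) / 2))"
    and ?e1 = "\<lambda>n. exp (real n * (s1 * (?V1 * (1 - \<delta>)) - ln (1 + 2 * s1 * ?V1) / 2))"
    and ?e2 = "\<lambda>n. exp (real n * (s2 * (?V2 * (1 - \<delta>)) - ln (1 + 2 * s2 * ?V2) / 2))"
    and ?e3 = "\<lambda>n. exp (real n * (RB * ln 2 + (\<delta> - ln ?V1 / 2)))"
    and ?e4 = "\<lambda>n. exp (real n * ((RA + RB) * ln 2 + (\<delta> - ln ?V2 / 2)))"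
    and ?eA = "\<lambda>n. exp (real n * (sA * PA - ln (1 + 2 * sA * cA\<^sup>2) / 2))"
    and ?eB = "\<lambda>n. exp (real n * (sB * PB - ln (1 + 2 * sB * cB\<^sup>2) / 2))"
  \<comment> \<open>The factors 2 and 4 = 2 * 2 are the rounding factors of one and of two code
    sizes.\<close>
  define \<epsilon> where "\<epsilon> n = ?e0 n + ?e1 n + ?e2 n + 2 * ?e3 n + 4 * ?e4 n + ?eA n + ?eB n" for n
  let ?E = "\<lambda>n. receiver_bound n \<delta> a cA cB PA PB s0 s1 s2 sA sB iA iB (MA n) (MB n)"
  let ?dec = "\<lambda>n \<omega>. dist_decoder n (1 + \<delta>) (MA n) (MB n) (\<lambda>i t. a * cA * \<omega> (iA, i) t) (\<lambda>j t. cB * \<omega> (iB, j) t)"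
  show thesis
  proof (rule that[of \<epsilon> ?E ?dec])
    have "\<epsilon> \<longlonglongrightarrow> 0 + 0 + 0 + 2 * 0 + 4 * 0 + 0 + 0"
      unfolding \<epsilon>_def using s0 s1 s2 sA sB g3 g4
      by (intro tendsto_intros exp_linear_null) auto
    then show "\<epsilon> \<longlonglongrightarrow> 0" by simp
    show "0 \<le> \<epsilon> n" for n unfolding \<epsilon>_def by (intro add_nonneg_nonneg) auto
    show "?E n i j \<in> borel_measurable (codebook n)" for n i j by (rule receiver_bound_measurable)
    show "decoder_ok n (?dec n \<omega>)" for n \<omega> by (rule dist_decoder_ok)
    show "ennreal (err_prob n (\<lambda>t. truncate_power n PB (\<lambda>t. cB * \<omega> (iB, j) t) t
              + a * truncate_power n PA (\<lambda>t. cA * \<omega> (iA, i) t) t) (?dec n \<omega>) j) \<le> ?E n i j \<omega>"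
      if "i < MA n" "j < MB n" for n \<omega> i j
      by (rule err_prob_le_receiver_bound[OF that s])
    fix n i j
    have pe: "2 powr (real n * r) = exp (real n * (r * ln 2))" for r by (simp add: powr_def mult.assoc)
    have M': "real (MA n) \<le> 2 * exp (real n * (RA * ln 2))" "real (MB n) \<le> 2 * exp (real n * (RB * ln 2))"
      by (simp_all only: pe[symmetric] M)
    have "real (MB n) * exp (real n * (\<delta> - ln ?V1 / 2)) \<le> 2 * exp (real n * (RB * ln 2)) * exp (real n * (\<delta> - ln ?V1 / 2))"
      by (intro mult_right_mono M') auto
    then have m3: "real (MB n) * exp (real n * (\<delta> - ln ?V1 / 2)) \<le> 2 * ?e3 n"
      by (simp only: mult.assoc mult_exp_exp distrib_left)
    have "real (MB n) * real (MA n) * exp (real n * (\<delta> - ln ?V2 / 2))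
       \<le> (2 * exp (real n * (RB * ln 2))) * (2 * exp (real n * (RA * ln 2))) * exp (real n * (\<delta> - ln ?V2 / 2))"
      by (intro mult_right_mono mult_mono M') auto
    also have "\<dots> = 4 * ?e4 n"
      by (simp add: mult_exp_exp algebra_simps)
    finally have m4: "real (MB n) * real (MA n) * exp (real n * (\<delta> - ln ?V2 / 2)) \<le> 4 * ?e4 n" .
    show "(\<integral>\<^sup>+\<omega>. ?E n i j \<omega> \<partial>codebook n) \<le> ennreal (\<epsilon> n)"
      by (rule order_trans[OF nn_integral_receiver_bound_le[OF i s0(2) s1(2) s2(2) sA(2) sB(2)]], rule ennreal_leI)
         (unfold \<epsilon>_def, intro add_mono order_refl m3 m4)
  qed
qed

section \<open>One codebook for all three receivers\<close>

lemma avg_err_le: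
  assumes e: "\<And>m1 m2 m3. m1 < M1 \<Longrightarrow> m2 < M2 \<Longrightarrow> m3 < M3 \<Longrightarrow>
      ennreal (err_prob n (sig m1 m2 m3) dec (sel m1 m2 m3)) \<le> F m1 m2 m3"
    and F: "(\<Sum>m1<M1. \<Sum>m2<M2. \<Sum>m3<M3. F m1 m2 m3) \<le> ennreal (real (M1 * M2 * M3) * \<eta>)"
    and N: "0 < real (M1 * M2 * M3)" and \<eta>: "0 \<le> \<eta>"
  shows "avg_err n M1 M2 M3 sig dec sel \<le> \<eta>"
proof -
  have e0: "0 \<le> err_prob n x d m" for x d m by (simp add: err_prob_def)
  have "ennreal (\<Sum>m1<M1. \<Sum>m2<M2. \<Sum>m3<M3. err_prob n (sig m1 m2 m3) dec (sel m1 m2 m3))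
     = (\<Sum>m1<M1. \<Sum>m2<M2. \<Sum>m3<M3. ennreal (err_prob n (sig m1 m2 m3) dec (sel m1 m2 m3)))"
    by (simp add: e0 sum_nonneg)
  also have "\<dots> \<le> (\<Sum>m1<M1. \<Sum>m2<M2. \<Sum>m3<M3. F m1 m2 m3)"
    using e by (intro sum_mono) auto
  also note F
  finally have "(\<Sum>m1<M1. \<Sum>m2<M2. \<Sum>m3<M3. err_prob n (sig m1 m2 m3) dec (sel m1 m2 m3)) \<le> real (M1 * M2 * M3) * \<eta>"
    using N \<eta> by (subst (asm) ennreal_le_iff) auto
  then show ?thesis using N unfolding avg_err_def by (simp add: field_simps)
qed

lemma avg_err_nonneg: "0 \<le> avg_err n M1 M2 M3 sig dec sel"
  by (auto simp: avg_err_def err_prob_def intro!: divide_nonneg_nonneg sum_nonneg)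

lemma exists_le_of_nn_integral:
  assumes "prob_space M" and "(\<integral>\<^sup>+x. f x \<partial>M) < C"
  obtains x where "x \<in> space M" "f x \<le> C"
proof -
  interpret prob_space M by fact
  have "\<exists>x\<in>space M. f x \<le> C"
  proof (rule ccontr)
    assume "\<not> (\<exists>x\<in>space M. f x \<le> C)"
    then have "(\<integral>\<^sup>+x. C \<partial>M) \<le> (\<integral>\<^sup>+x. f x \<partial>M)"
      by (intro nn_integral_mono) (auto simp: not_le intro: less_imp_le)
    then show False using assms(2) by (simp add: emeasure_space_1)
  qed
  then show thesis using that by blast
qed

lemma cgzic_achievable_interior:
  fixes a1 a2 c1 c2 c3 :: real
  assumes R: "0 \<le> R1" "0 \<le> R2" "0 \<le> R3"
    and c: "0 < c1" "0 < c2" "0 < c3" "c1\<^sup>2 < P1" "c2\<^sup>2 < P2" "c3\<^sup>2 < P3"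
    and C: "R1 < Cg (c1\<^sup>2)" "R2 < Cg (c2\<^sup>2)" "R3 < Cg (c3\<^sup>2)"
      "R1 + R2 < Cg ((a1 * c1)\<^sup>2 + c2\<^sup>2)" "R2 + R3 < Cg ((a2 * c2)\<^sup>2 + c3\<^sup>2)"
  shows "(R1, R2, R3) \<in> cgzic_achievable a1 a2 P1 P2 P3"
proof -
  \<comment> \<open>Rounding up a number that is at least one at most doubles it.\<close>
  define M where "M r n = nat \<lceil>2 powr (real n * r)\<rceil>" for r :: real and n :: nat
  have Ml: "2 powr (real n * r) \<le> real (M r n)" for r n
    unfolding M_def by linarith
  have Mu: "real (M r n) \<le> 2 * 2 powr (real n * r)" if "0 \<le> r" for r n
  proof -
    have "1 \<le> 2 powr (real n * r)" using that by (intro ge_one_powr_ge_zero) auto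
    then show ?thesis unfolding M_def by linarith
  qed
  have Mp: "0 < M r n" for r n
    using less_le_trans[OF _ Ml, of 0] by simp
  have P: "0 \<le> P1" "0 \<le> P2" "0 \<le> P3" using c by (meson less_imp_le order_trans zero_le_power2)+
  \<comment> \<open>Receiver 1 is the case a = 0 with a single interfering codeword.\<close>
  obtain E1 \<epsilon>1 dec1 where 1: "\<epsilon>1 \<longlonglongrightarrow> 0" "\<And>n. 0 \<le> \<epsilon>1 n"
    "\<And>n i j. E1 n i j \<in> borel_measurable (codebook n)"
    "\<And>n i j. (\<integral>\<^sup>+\<omega>. E1 n i j \<omega> \<partial>codebook n) \<le> ennreal (\<epsilon>1 n)"
    "\<And>n \<omega>. decoder_ok n (dec1 n \<omega>)"
    "\<And>n \<omega> i j. i < 1 \<Longrightarrow> j < M R1 n \<Longrightarrow>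
       ennreal (err_prob n (\<lambda>t. truncate_power n P1 (\<lambda>t. c1 * \<omega> (1, j) t) t
              + 0 * truncate_power n P2 (\<lambda>t. c2 * \<omega> (2, i) t) t) (dec1 n \<omega>) j) \<le> E1 n i j \<omega>"
    by (rule random_coding_receiver[of 2 1 c2 c1 P2 P1 R1 0 0 "\<lambda>_. 1" "M R1"])
       (use c C R Mu in auto)
  obtain E2 \<epsilon>2 dec2 where 2: "\<epsilon>2 \<longlonglongrightarrow> 0" "\<And>n. 0 \<le> \<epsilon>2 n"
    "\<And>n i j. E2 n i j \<in> borel_measurable (codebook n)"
    "\<And>n i j. (\<integral>\<^sup>+\<omega>. E2 n i j \<omega> \<partial>codebook n) \<le> ennreal (\<epsilon>2 n)"
    "\<And>n \<omega>. decoder_ok n (dec2 n \<omega>)"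
    "\<And>n \<omega> i j. i < M R1 n \<Longrightarrow> j < M R2 n \<Longrightarrow>
       ennreal (err_prob n (\<lambda>t. truncate_power n P2 (\<lambda>t. c2 * \<omega> (2, j) t) t
              + a1 * truncate_power n P1 (\<lambda>t. c1 * \<omega> (1, i) t) t) (dec2 n \<omega>) j) \<le> E2 n i j \<omega>"
    by (rule random_coding_receiver[of 1 2 c1 c2 P1 P2 R2 R1 a1 "M R1" "M R2"])
       (use c C R Mu in auto)
  obtain E3 \<epsilon>3 dec3 where 3: "\<epsilon>3 \<longlonglongrightarrow> 0" "\<And>n. 0 \<le> \<epsilon>3 n"
    "\<And>n i j. E3 n i j \<in> borel_measurable (codebook n)"
    "\<And>n i j. (\<integral>\<^sup>+\<omega>. E3 n i j \<omega> \<partial>codebook n) \<le> ennreal (\<epsilon>3 n)"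
    "\<And>n \<omega>. decoder_ok n (dec3 n \<omega>)"
    "\<And>n \<omega> i j. i < M R2 n \<Longrightarrow> j < M R3 n \<Longrightarrow>
       ennreal (err_prob n (\<lambda>t. truncate_power n P3 (\<lambda>t. c3 * \<omega> (3, j) t) t
              + a2 * truncate_power n P2 (\<lambda>t. c2 * \<omega> (2, i) t) t) (dec3 n \<omega>) j) \<le> E3 n i j \<omega>"
    by (rule random_coding_receiver[of 2 3 c2 c3 P2 P3 R3 R2 a2 "M R2" "M R3"])
       (use c C R Mu in auto)
  \<comment> \<open>The extra 1 / Suc n makes the mean strictly smaller than the target, as
    \<open>exists_le_of_nn_integral\<close> demands.\<close>
  define \<eta> where "\<eta> n = \<epsilon>1 n + \<epsilon>2 n + \<epsilon>3 n + 1 / real (Suc n)" for n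
  have \<eta>0: "0 \<le> \<eta> n" for n using 1(2)[of n] 2(2)[of n] 3(2)[of n] by (simp add: \<eta>_def)
  have "\<eta> \<longlonglongrightarrow> 0 + 0 + 0 + 0"
    unfolding \<eta>_def by (intro tendsto_add 1 2 3 LIMSEQ_Suc[OF lim_1_over_n])
  then have \<eta>lim: "\<eta> \<longlonglongrightarrow> 0" by simp
  let ?N = "\<lambda>n. real (M R1 n * M R2 n * M R3 n)"
  have N: "0 < ?N n" for n using Mp by simp
  \<comment> \<open>In \<open>E1\<close> the index 0 is the only message of the interferer that
    receiver 1 hears with gain zero.\<close>
  let ?F = "\<lambda>n \<omega> m1 m2 m3. E1 n 0 m1 \<omega> + E2 n m1 m2 \<omega> + E3 n m2 m3 \<omega>"
  \<comment> \<open>One codebook is chosen for the sum of the three majorants. Each receiver's error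
    is below the sum, so all three averages are at most \<open>\<eta> n\<close>
    simultaneously.\<close>
  have ex: "\<forall>n. \<exists>\<omega>. (\<Sum>m1<M R1 n. \<Sum>m2<M R2 n. \<Sum>m3<M R3 n. ?F n \<omega> m1 m2 m3) \<le> ennreal (?N n * \<eta> n)"
  proof
    fix n
    note [measurable] = 1(3) 2(3) 3(3)
    have Fi: "(\<integral>\<^sup>+\<omega>. ?F n \<omega> m1 m2 m3 \<partial>codebook n) \<le> ennreal (\<epsilon>1 n + \<epsilon>2 n + \<epsilon>3 n)" for m1 m2 m3
    proof -
      have "(\<integral>\<^sup>+\<omega>. ?F n \<omega> m1 m2 m3 \<partial>codebook n) =
        (\<integral>\<^sup>+\<omega>. E1 n 0 m1 \<omega> \<partial>codebook n) + (\<integral>\<^sup>+\<omega>. E2 n m1 m2 \<omega> \<partial>codebook n) + (\<integral>\<^sup>+\<omega>. E3 n m2 m3 \<omega> \<partial>codebook n)"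
        by (simp add: nn_integral_add)
      also have "\<dots> \<le> ennreal (\<epsilon>1 n) + ennreal (\<epsilon>2 n) + ennreal (\<epsilon>3 n)"
        by (intro add_mono 1 2 3)
      finally show ?thesis using 1(2)[of n] 2(2)[of n] 3(2)[of n] by simp
    qed
    have "(\<integral>\<^sup>+\<omega>. (\<Sum>m1<M R1 n. \<Sum>m2<M R2 n. \<Sum>m3<M R3 n. ?F n \<omega> m1 m2 m3) \<partial>codebook n)
      = (\<Sum>m1<M R1 n. \<Sum>m2<M R2 n. \<Sum>m3<M R3 n. \<integral>\<^sup>+\<omega>. ?F n \<omega> m1 m2 m3 \<partial>codebook n)"
      by (simp add: nn_integral_sum)
    also have "\<dots> \<le> (\<Sum>m1<M R1 n. \<Sum>m2<M R2 n. \<Sum>m3<M R3 n. ennreal (\<epsilon>1 n + \<epsilon>2 n + \<epsilon>3 n))"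
      by (intro sum_mono Fi)
    also have "\<dots> = ennreal (?N n * (\<epsilon>1 n + \<epsilon>2 n + \<epsilon>3 n))"
      using 1(2)[of n] 2(2)[of n] 3(2)[of n]
      by (simp add: ennreal_mult ennreal_of_nat_eq_real_of_nat mult.assoc del: ennreal_plus)
    also have "\<dots> < ennreal (?N n * \<eta> n)"
      using N[of n] 1(2)[of n] 2(2)[of n] 3(2)[of n] 
      by (intro ennreal_lessI mult_pos_pos mult_strict_left_mono) (auto simp: \<eta>_def intro!: add_nonneg_pos)
    finally obtain \<omega> where "(\<Sum>m1<M R1 n. \<Sum>m2<M R2 n. \<Sum>m3<M R3 n. ?F n \<omega> m1 m2 m3) \<le> ennreal (?N n * \<eta> n)"
      by (rule exists_le_of_nn_integral[OF prob_space_codebook]) blast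
    then show "\<exists>\<omega>. (\<Sum>m1<M R1 n. \<Sum>m2<M R2 n. \<Sum>m3<M R3 n. ?F n \<omega> m1 m2 m3) \<le> ennreal (?N n * \<eta> n)" by blast
  qed
  from choice[OF ex] obtain \<omega> where \<omega>: "\<And>n. (\<Sum>m1<M R1 n. \<Sum>m2<M R2 n. \<Sum>m3<M R3 n. ?F n (\<omega> n) m1 m2 m3) \<le> ennreal (?N n * \<eta> n)"
    by blast
  define e where "e i P c n m = truncate_power n P (\<lambda>t. c * \<omega> n (i, m) t)" for i P c n m
  define e1 e2 e3 where "e1 = e 1 P1 c1" and "e2 = e 2 P2 c2" and "e3 = e 3 P3 c3"
  let ?a1 = "\<lambda>n. avg_err n (M R1 n) (M R2 n) (M R3 n) (\<lambda>m1 m2 m3. e1 n m1) (dec1 n (\<omega> n)) (\<lambda>m1 m2 m3. m1)"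
    and ?a2 = "\<lambda>n. avg_err n (M R1 n) (M R2 n) (M R3 n) (\<lambda>m1 m2 m3 t. e2 n m2 t + a1 * e1 n m1 t) (dec2 n (\<omega> n)) (\<lambda>m1 m2 m3. m2)"
    and ?a3 = "\<lambda>n. avg_err n (M R1 n) (M R2 n) (M R3 n) (\<lambda>m1 m2 m3 t. e3 n m3 t + a2 * e2 n m2 t) (dec3 n (\<omega> n)) (\<lambda>m1 m2 m3. m3)"
  have b1: "?a1 n \<le> \<eta> n" for n
  proof (rule avg_err_le[OF _ \<omega> N \<eta>0])
    fix m1 m2 m3 assume "m1 < M R1 n"
    then have "ennreal (err_prob n (e1 n m1) (dec1 n (\<omega> n)) m1) \<le> E1 n 0 m1 (\<omega> n)"
      using 1(6)[of 0 m1 n "\<omega> n"] by (simp add: e1_def e_def)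
    then show "ennreal (err_prob n (e1 n m1) (dec1 n (\<omega> n)) m1) \<le> ?F n (\<omega> n) m1 m2 m3"
      by (rule order_trans) (simp add: add.assoc add_increasing2)
  qed
  have b2: "?a2 n \<le> \<eta> n" for n
  proof (rule avg_err_le[OF _ \<omega> N \<eta>0])
    fix m1 m2 m3 assume "m1 < M R1 n" "m2 < M R2 n"
    then have "ennreal (err_prob n (\<lambda>t. e2 n m2 t + a1 * e1 n m1 t) (dec2 n (\<omega> n)) m2) \<le> E2 n m1 m2 (\<omega> n)"
      using 2(6)[of m1 n m2 "\<omega> n"] by (simp add: e1_def e2_def e_def)
    then show "ennreal (err_prob n (\<lambda>t. e2 n m2 t + a1 * e1 n m1 t) (dec2 n (\<omega> n)) m2) \<le> ?F n (\<omega> n) m1 m2 m3"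
      by (rule order_trans) (simp add: add_increasing add_increasing2)
  qed
  have b3: "?a3 n \<le> \<eta> n" for n
  proof (rule avg_err_le[OF _ \<omega> N \<eta>0])
    fix m1 m2 m3 assume "m2 < M R2 n" "m3 < M R3 n"
    then have "ennreal (err_prob n (\<lambda>t. e3 n m3 t + a2 * e2 n m2 t) (dec3 n (\<omega> n)) m3) \<le> E3 n m2 m3 (\<omega> n)"
      using 3(6)[of m2 n m3 "\<omega> n"] by (simp add: e2_def e3_def e_def)
    then show "ennreal (err_prob n (\<lambda>t. e3 n m3 t + a2 * e2 n m2 t) (dec3 n (\<omega> n)) m3) \<le> ?F n (\<omega> n) m1 m2 m3"
      by (rule order_trans) (simp add: add_increasing)
  qed
  have lim: "?a1 \<longlonglongrightarrow> 0" "?a2 \<longlonglongrightarrow> 0" "?a3 \<longlonglongrightarrow> 0"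
    by (rule tendsto_sandwich[OF _ _ tendsto_const \<eta>lim]; simp add: avg_err_nonneg b1 b2 b3)+
  have pw: "power_ok n P1 (M R1 n) (e1 n)" "power_ok n P2 (M R2 n) (e2 n)" "power_ok n P3 (M R3 n) (e3 n)" for n
    unfolding e1_def e2_def e3_def e_def by (intro power_ok_truncate P)+
  show ?thesis
    unfolding cgzic_achievable_def mem_Collect_eq prod.case
    by (intro conjI R, rule exI[of _ "M R1"], rule exI[of _ "M R2"], rule exI[of _ "M R3"],
        rule exI[of _ e1], rule exI[of _ e2], rule exI[of _ e3], rule exI[of _ "\<lambda>n. dec1 n (\<omega> n)"],
        rule exI[of _ "\<lambda>n. dec2 n (\<omega> n)"], rule exI[of _ "\<lambda>n. dec3 n (\<omega> n)"])
       (intro conjI allI Ml pw 1(5) 2(5) 3(5) lim)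
qed

section \<open>From strict inequalities to the closed region\<close>

text \<open>By continuity of \<open>Cg\<close> the strict inequalities survive multiplying all
  powers by some \<theta> < 1. The amplitudes sqrt (\<theta> P) then leave the slack in power that
  the random code consumes.\<close>

lemma cgzic_achievable_strict:
  assumes P: "P1 > 0" "P2 > 0" "P3 > 0" and R: "0 \<le> R1" "0 \<le> R2" "0 \<le> R3"
    and C: "R1 < Cg P1" "R2 < Cg P2" "R3 < Cg P3"
      "R1 + R2 < Cg (a1\<^sup>2 * P1 + P2)" "R2 + R3 < Cg (a2\<^sup>2 * P2 + P3)"
  shows "(R1, R2, R3) \<in> cgzic_achievable a1 a2 P1 P2 P3"
proof -
  have lim: "((\<lambda>\<theta>. Cg (\<theta> * x)) \<longlongrightarrow> Cg (1 * x)) (at_left 1)" if "x > 0" for x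
    unfolding Cg_def log_def using that by (intro tendsto_intros) auto
  have ev: "\<forall>\<^sub>F \<theta> in at_left 1. r < Cg (\<theta> * x)" if "x > 0" "r < Cg x" for r x
    using order_tendstoD(1)[OF lim[OF that(1)]] that(2) by simp
  have pos: "a1\<^sup>2 * P1 + P2 > 0" "a2\<^sup>2 * P2 + P3 > 0" using P by (simp_all add: add_nonneg_pos)
  have "\<forall>\<^sub>F \<theta> in at_left (1::real). 0 < \<theta> \<and> \<theta> < 1"
    by (auto simp: eventually_at_left_field intro!: exI[of _ 0])
  then have "\<forall>\<^sub>F \<theta> in at_left (1::real). 0 < \<theta> \<and> \<theta> < 1 \<and> R1 < Cg (\<theta> * P1) \<and> R2 < Cg (\<theta> * P2) \<and> R3 < Cg (\<theta> * P3)
     \<and> R1 + R2 < Cg (\<theta> * (a1\<^sup>2 * P1 + P2)) \<and> R2 + R3 < Cg (\<theta> * (a2\<^sup>2 * P2 + P3))"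
    using ev[OF P(1) C(1)] ev[OF P(2) C(2)] ev[OF P(3) C(3)] ev[OF pos(1) C(4)] ev[OF pos(2) C(5)]
    by eventually_elim auto
  then obtain \<theta> where t: "0 < \<theta>" "\<theta> < 1" "R1 < Cg (\<theta> * P1)" "R2 < Cg (\<theta> * P2)" "R3 < Cg (\<theta> * P3)"
     "R1 + R2 < Cg (\<theta> * (a1\<^sup>2 * P1 + P2))" "R2 + R3 < Cg (\<theta> * (a2\<^sup>2 * P2 + P3))"
    using eventually_happens'[OF trivial_limit_at_left_real] by blast
  have sq: "(sqrt (\<theta> * p))\<^sup>2 = \<theta> * p" "0 < sqrt (\<theta> * p)" "\<theta> * p < p" if "p > 0" for p
    using that t by auto
  show ?thesis
    by (rule cgzic_achievable_interior[OF R, of "sqrt (\<theta> * P1)" "sqrt (\<theta> * P2)" "sqrt (\<theta> * P3)"])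
       (use t sq P in \<open>auto simp: power_mult_distrib algebra_simps\<close>)
qed

theorem theorem2:
  fixes a1 a2 P1 P2 P3 :: real
  assumes "P1 > 0" "P2 > 0" "P3 > 0"
    and "1 \<le> a1" "a1 < sqrt (1 + P2)"
    and "1 \<le> a2" "a2 < sqrt (1 + P3)"
  shows "cgzic_capacity_region a1 a2 P1 P2 P3 =
    {(R1, R2, R3). 0 \<le> R1 \<and> 0 \<le> R2 \<and> 0 \<le> R3 \<and>
       R1 \<le> Cg P1 \<and> R2 \<le> Cg P2 \<and> R3 \<le> Cg P3 \<and>
       R1 \<le> Cg (a1\<^sup>2 * P1) \<and> R2 \<le> Cg (a2\<^sup>2 * P2) \<and>
       R1 + R2 \<le> Cg (a1\<^sup>2 * P1 + P2) \<and> R2 + R3 \<le> Cg (a2\<^sup>2 * P2 + P3)}"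
    (is "_ = ?S")
proof
  have Cg_mono: "Cg x \<le> Cg y" if "0 \<le> x" "x \<le> y" for x y
    using that by (simp add: Cg_def)
  \<comment> \<open>Since the gains are at least one, the bounds with a_j^2 P_j follow from those
    with P_j by monotonicity.\<close>
  have "1 \<le> a1\<^sup>2" "1 \<le> a2\<^sup>2" using assms by (simp_all add: one_le_power)
  then have le: "P1 \<le> a1\<^sup>2 * P1" "P2 \<le> a2\<^sup>2 * P2"
    using assms by (simp_all add: mult_le_cancel_right1)
  have "closed ?S"
    unfolding case_prod_beta'
    by (intro closed_Collect_conj closed_Collect_le continuous_intros)
  moreover have "cgzic_achievable a1 a2 P1 P2 P3 \<subseteq> ?S"
  proof clarify
    fix R1 R2 R3 assume "(R1, R2, R3) \<in> cgzic_achievable a1 a2 P1 P2 P3"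
    from cgzic_converse[OF assms(1-3,4,6) this] Cg_mono[OF _ le(1)] Cg_mono[OF _ le(2)] assms
    show "0 \<le> R1 \<and> 0 \<le> R2 \<and> 0 \<le> R3 \<and>
       R1 \<le> Cg P1 \<and> R2 \<le> Cg P2 \<and> R3 \<le> Cg P3 \<and>
       R1 \<le> Cg (a1\<^sup>2 * P1) \<and> R2 \<le> Cg (a2\<^sup>2 * P2) \<and>
       R1 + R2 \<le> Cg (a1\<^sup>2 * P1 + P2) \<and> R2 + R3 \<le> Cg (a2\<^sup>2 * P2 + P3)" by auto
  qed
  ultimately show "cgzic_capacity_region a1 a2 P1 P2 P3 \<subseteq> ?S"
    unfolding cgzic_capacity_region_def by (rule closure_minimal[rotated])
  show "?S \<subseteq> cgzic_capacity_region a1 a2 P1 P2 P3"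
  proof clarify
    fix R1 R2 R3 assume R: "0 \<le> R1" "0 \<le> R2" "0 \<le> R3" "R1 \<le> Cg P1" "R2 \<le> Cg P2" "R3 \<le> Cg P3"
      "R1 + R2 \<le> Cg (a1\<^sup>2 * P1 + P2)" "R2 + R3 \<le> Cg (a2\<^sup>2 * P2 + P3)"
    \<comment> \<open>Shrinking a triple towards the origin makes all inequalities strict, because
      every capacity on the right is positive; the shrunken triples converge to the given
      one.\<close>
    define \<theta> where "\<theta> k = 1 - 1 / real (Suc k)" for k
    have \<theta>: "0 \<le> \<theta> k" "\<theta> k < 1" for k by (auto simp: \<theta>_def)
    have lt: "\<theta> k * r < Cg x" if "0 \<le> r" "r \<le> Cg x" "0 < x" for k r x
    proof -
      have "Cg x > 0" using that(3) by (simp add: Cg_def)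
      have "\<theta> k * r \<le> \<theta> k * Cg x" using that \<theta> by (intro mult_left_mono) auto
      also have "\<dots> < Cg x" using \<open>Cg x > 0\<close> \<theta>[of k] by simp
      finally show ?thesis .
    qed
    have pos: "a1\<^sup>2 * P1 + P2 > 0" "a2\<^sup>2 * P2 + P3 > 0" using assms by (simp_all add: add_nonneg_pos)
    have "(\<theta> k * R1, \<theta> k * R2, \<theta> k * R3) \<in> cgzic_achievable a1 a2 P1 P2 P3" for k
      using lt[of R1 P1 k] lt[of R2 P2 k] lt[of R3 P3 k] lt[OF _ R(7) pos(1), of k] lt[OF _ R(8) pos(2), of k] R assms \<theta>[of k]
      by (intro cgzic_achievable_strict assms) (auto simp: distrib_left)
    moreover have "(\<lambda>k. (\<theta> k * R1, \<theta> k * R2, \<theta> k * R3)) \<longlonglongrightarrow> (R1, R2, R3)"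
    proof -
      have "\<theta> \<longlonglongrightarrow> 1 - 0" unfolding \<theta>_def by (intro tendsto_diff tendsto_const LIMSEQ_Suc[OF lim_1_over_n])
      then have "(\<lambda>k. (\<theta> k * R1, \<theta> k * R2, \<theta> k * R3)) \<longlonglongrightarrow> (1 * R1, 1 * R2, 1 * R3)"
        by (intro tendsto_Pair tendsto_mult tendsto_const) auto
      then show ?thesis by simp
    qed
    ultimately show "(R1, R2, R3) \<in> cgzic_capacity_region a1 a2 P1 P2 P3"
      unfolding cgzic_capacity_region_def closure_sequential
      by (intro exI[of _ "\<lambda>k. (\<theta> k * R1, \<theta> k * R2, \<theta> k * R3)"]) auto
  qed
qed

end
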